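(* Let $\Gamma,\alpha,\kappa,c_v>0$ be constants and set $\nu=\kappa/c_v$. For every choice of left data $\rho_0>0$, $u_0>0$, $e_0>0$ and right data $u_1>0$, $e_1>0$, there exists at least one steady solution on $[0,1]$ of the one-dimensional compressible Navier--Stokes equations with these boundary data; that is, there exist functions $\rho,u,e:[0,1]\to(0,\infty)$, with $\rho\in C^1([0,1])$ and $u,e\in C^2([0,1])$, satisfying on $[0,1]$ $$(\rho u)_x=0,\qquad (\rho u^2+\Gamma\rho e)_x=\alpha u_{xx},\qquad \Big(\rho u\big(e+\tfrac{u^2}{2}\big)+\Gamma\rho e u\Big)_x=\nu e_{xx}+(\alpha u u_x)_x,$$ together with $$(\rho,u,e)(0)=(\rho_0,u_0,e_0),\qquad (u,e)(1)=(u_1,e_1).$$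
   Context: The full (nonisentropic) polytropic gas dynamics equations are $$\rho_t+(\rho u)_x=0,\quad (\rho u)_t+(\rho u^2+p)_x=\alpha u_{xx},\quad (\rho E)_t+(\rho uE+pu)_x=\kappa T_{xx}+(\alpha uu_x)_x,$$ with $E=e+\frac{u^2}{2}$, $p=\Gamma\rho e$, $e=c_vT$, and $\Gamma,c_v,\alpha,\kappa$ fixed positive constants, $\nu=\kappa/c_v$. A steady solution is a time-independent solution; the system in the claim is the time-independent version. The boundary conditions are of noncharacteristic inflow-outflow type (velocity positive at both ends). Solutions are understood to be physical, i.e. $\rho,u,e>0$. *)

theory Defs
  imports "HOL-Analysis.Analysis"
begin

text \<open>Derivatives on the closed interval \<open>[0,1]\<close> are taken within the interval, so they are
  one-sided at the endpoints; the values of a function outside \<open>[0,1]\<close> play no role.\<close>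

definition dx :: "(real \<Rightarrow> real) \<Rightarrow> real \<Rightarrow> real" where
  "dx f x = vector_derivative f (at x within {0..1})"

lemma dx_unique:
  assumes "x \<in> {0..1}" "(f has_real_derivative d) (at x within {0..1})"
  shows "dx f x = d"
  unfolding dx_def using assms
  by (intro vector_derivative_within_closed_interval)
     (auto simp: has_real_derivative_iff_has_vector_derivative)

text \<open>\<open>Ck_unit k f\<close>: the restriction of \<open>f\<close> to \<open>[0,1]\<close> belongs to \<open>C\<^sup>k([0,1])\<close>. The notion
  \<open>C1_differentiable_on\<close> of the library is not used because it demands two-sided derivatives.\<close>

primrec Ck_unit :: "nat \<Rightarrow> (real \<Rightarrow> real) \<Rightarrow> bool" where
  "Ck_unit 0 f \<longleftrightarrow> continuous_on {0..1} f"
| "Ck_unit (Suc k) f \<longleftrightarrow> f differentiable_on {0..1} \<and> Ck_unit k (dx f)"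

text \<open>The steady equations with pressure \<open>p = \<Gamma> \<rho> e\<close>, total energy \<open>E = e + u\<^sup>2/2\<close> and temperature
  \<open>T = e/c\<^sub>v\<close> substituted, so that \<open>\<kappa> T\<^sub>x\<^sub>x = \<nu> e\<^sub>x\<^sub>x\<close> with \<open>\<nu> = \<kappa>/c\<^sub>v\<close>.\<close>

definition steady_NS_solution ::
    "real \<Rightarrow> real \<Rightarrow> real \<Rightarrow> (real \<Rightarrow> real) \<Rightarrow> (real \<Rightarrow> real) \<Rightarrow> (real \<Rightarrow> real) \<Rightarrow> bool" where
  "steady_NS_solution \<Gamma> \<alpha> \<nu> \<rho> u e \<longleftrightarrow>
     Ck_unit 1 \<rho> \<and> Ck_unit 2 u \<and> Ck_unit 2 e \<and>
     (\<forall>x\<in>{0..1}. \<rho> x > 0 \<and> u x > 0 \<and> e x > 0) \<and>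
     (\<forall>x\<in>{0..1}.
        dx (\<lambda>y. \<rho> y * u y) x = 0 \<and>
        dx (\<lambda>y. \<rho> y * (u y)\<^sup>2 + \<Gamma> * \<rho> y * e y) x = \<alpha> * dx (dx u) x \<and>
        dx (\<lambda>y. \<rho> y * u y * (e y + (u y)\<^sup>2 / 2) + \<Gamma> * \<rho> y * e y * u y) x
          = \<nu> * dx (dx e) x + dx (\<lambda>y. \<alpha> * u y * dx u y) x)"

end

theory Submission
  imports Defs
begin

text \<open>With \<open>m = \<rho>\<^sub>0 u\<^sub>0\<close> the conserved mass flux, \<open>a = \<alpha> / m\<close> and \<open>n = \<nu> / m\<close>, the momentum and energy
  equations integrate once to
  \[ a u' = u + \Gamma e / u - c_1, \qquad n e' = e + c_1 u - u^2 / 2 - c_2, \]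
  and the problem is to find the constants \<open>c\<^sub>1, c\<^sub>2\<close> for which the solution starting at \<open>(u\<^sub>0, e\<^sub>0)\<close>
  ends at \<open>(u\<^sub>1, e\<^sub>1)\<close>. The vector field is truncated to a globally Lipschitz one, which makes the
  shooting map a continuous map of the plane, and is deformed to a linear system. Along the deformation
  the constants of all solutions of the boundary value problem stay in a fixed ball, so Brouwer's fixed
  point theorem yields a solution of the truncated problem. A maximum principle (\<open>e > 0\<close>), an upper
  bound on \<open>c\<^sub>1\<close> and \<open>c\<^sub>2\<close> that does not depend on the truncation, and finally a lower bound on \<open>u\<close> show
  that the truncation is not active for this solution.\<close>

section \<open>Differential inequalities\<close>

text \<open>Eliminating the viscous work between the two integrated equations also removes the
  pressure from the energy equation, so the singular quotient \<open>e / u\<close> occurs only in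
  the equation for \<open>u\<close>. It has to be cut off at some level \<open>\<delta>\<close>, and
  the admissible \<open>\<delta>\<close> depends on the size of \<open>c\<^sub>1\<close>; a bound on
  \<open>c\<^sub>1\<close> that involved \<open>\<delta>\<close> would therefore be circular. The
  bound free of \<open>\<delta>\<close> rests on \<open>e > 0\<close>, which is available only with
  the full energy source. This dictates the order of the deformation: while the source is being
  switched on there is no pressure, and the linear equation for \<open>u\<close> bounds
  \<open>c\<^sub>1\<close> by itself; the pressure enters only once the source is complete. The
  lower bound on \<open>u\<close> is needed only at the end of the deformation.\<close>

lemma nondecreasing_within:
  fixes f f' :: "real \<Rightarrow> real"
  assumes "s \<le> t"
    and der: "\<And>x. x \<in> {s..t} \<Longrightarrow> (f has_real_derivative f' x) (at x within {s..t})"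
    and nonneg: "\<And>x. x \<in> {s..t} \<Longrightarrow> f' x \<ge> 0"
  shows "f s \<le> f t"
proof (rule DERIV_nonneg_imp_increasing_open[OF \<open>s \<le> t\<close>])
  show "\<exists>y. DERIV f x :> y \<and> y \<ge> 0" if "s < x" "x < t" for x
    using der[of x] nonneg[of x] that by (auto simp: at_within_Icc_at)
  show "continuous_on {s..t} f"
    by (rule DERIV_continuous_on[OF der])
qed

text \<open>Integrating factor: \<open>(f x - K) * exp (- r * x)\<close> is nondecreasing. The rate
  may have either sign; a negative one occurs in \<open>e_pos\<close>.\<close>

lemma exponential_growth:
  fixes f f' :: "real \<Rightarrow> real"
  assumes "s \<le> t"
    and der: "\<And>x. x \<in> {s..t} \<Longrightarrow> (f has_real_derivative f' x) (at x within {s..t})"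
    and growth: "\<And>x. x \<in> {s..t} \<Longrightarrow> f' x \<ge> r * (f x - K)"
  shows "f t - K \<ge> (f s - K) * exp (r * (t - s))"
proof -
  have "(f s - K) * exp (- r * s) \<le> (f t - K) * exp (- r * t)"
  proof (rule nondecreasing_within[OF \<open>s \<le> t\<close>])
    show "((\<lambda>x. (f x - K) * exp (- r * x)) has_real_derivative
        (f' x - r * (f x - K)) * exp (- r * x)) (at x within {s..t})" if "x \<in> {s..t}" for x
      by (rule derivative_eq_intros der[OF that] refl | simp add: algebra_simps)+
  qed (use growth in simp)
  then have "(f s - K) * exp (- r * s) * exp (r * t) \<le> (f t - K) * exp (- r * t) * exp (r * t)"
    by (rule mult_right_mono) simp
  then show ?thesis
    by (simp add: mult.assoc exp_add[symmetric] algebra_simps)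
qed

lemma exponential_growth_upper:
  fixes f f' :: "real \<Rightarrow> real"
  assumes "s \<le> t"
    and der: "\<And>x. x \<in> {s..t} \<Longrightarrow> (f has_real_derivative f' x) (at x within {s..t})"
    and growth: "\<And>x. x \<in> {s..t} \<Longrightarrow> f' x \<le> r * (f x - K)"
  shows "f t - K \<le> (f s - K) * exp (r * (t - s))"
proof -
  have "- f t - (- K) \<ge> (- f s - (- K)) * exp (r * (t - s))"
  proof (rule exponential_growth[OF \<open>s \<le> t\<close>])
    show "((\<lambda>x. - f x) has_real_derivative - f' x) (at x within {s..t})" if "x \<in> {s..t}" for x
      by (rule derivative_intros der that)+
    show "r * (- f x - - K) \<le> - f' x" if "x \<in> {s..t}" for x
      using growth[OF that] by (simp add: algebra_simps)
  qed
  then show ?thesis by (simp add: algebra_simps)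
qed

text \<open>Barrier argument in which the sign of \<open>f'\<close> is required only at a contact
  point up to which \<open>f\<close> has stayed below \<open>K\<close>; this history is what makes
  the sign provable in \<open>c1_upper\<close> and \<open>u_ge_\<delta>\<close>.\<close>

lemma stay_below:
  fixes f f' :: "real \<Rightarrow> real"
  assumes "s \<le> t"
    and der: "\<And>x. x \<in> {s..t} \<Longrightarrow> (f has_real_derivative f' x) (at x within {s..t})"
    and start: "f s \<le> K"
    and neg: "\<And>r. \<lbrakk>s \<le> r; r \<le> t; f r = K; \<And>x. \<lbrakk>s \<le> x; x \<le> r\<rbrakk> \<Longrightarrow> f x \<le> K\<rbrakk> \<Longrightarrow> f' r < 0"
    and "x \<in> {s..t}"
  shows "f x \<le> K"
proof (rule ccontr)
  assume "\<not> f x \<le> K"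
  define A where "A = {y \<in> {s..t}. f y > K}"
  define r where "r = Inf A"
  have cont: "continuous_on {s..t} f"
    by (rule DERIV_continuous_on[OF der])
  have x: "x \<in> A" using \<open>\<not> f x \<le> K\<close> \<open>x \<in> {s..t}\<close> by (simp add: A_def)
  have bdd: "bdd_below A" by (auto simp: A_def bdd_below_def)
  have "s \<le> r" unfolding r_def using x by (intro cInf_greatest) (auto simp: A_def)
  moreover have "r \<le> x" unfolding r_def using x bdd by (rule cInf_lower)
  ultimately have r: "s \<le> r" "r \<le> t" using \<open>x \<in> {s..t}\<close> by auto
  have before: "f y \<le> K" if "s \<le> y" "y < r" for y
  proof (rule ccontr)
    assume "\<not> f y \<le> K"
    then have "y \<in> A" using that r by (simp add: A_def)
    then have "r \<le> y" unfolding r_def using bdd by (rule cInf_lower)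
    then show False using that by simp
  qed
  have below: "f r \<le> K"
  proof (cases "s = r")
    case False
    then have "s < r" using r by simp
    have "continuous_on {s..r} f" using cont r by (auto intro: continuous_on_subset)
    moreover have "closure {s..<r} = {s..r}" using \<open>s < r\<close> by simp
    ultimately show ?thesis
      using continuous_le_on_closure[of "{s..<r}" f r K] before \<open>s < r\<close> by simp
  qed (use start in simp)
  \<comment> \<open>Extending the bound beyond the infimum \<open>r\<close> of the exceedance set is
    contradictory. The derivative does it if \<open>f\<close> touches \<open>K\<close> at
    \<open>r\<close>, continuity otherwise.\<close>
  have "\<exists>d>0. \<forall>y. r < y \<longrightarrow> y < r + d \<longrightarrow> y \<le> t \<longrightarrow> f y \<le> K"
  proof (cases "f r = K")
    case True
    have "f' r < 0" using neg[OF r True] before below by (metis order_le_less)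
    then obtain d where "d > 0" and d: "\<forall>h>0. r + h \<in> {s..t} \<longrightarrow> h < d \<longrightarrow> f r > f (r + h)"
      using has_real_derivative_neg_dec_right[OF der, of r] r by auto
    have "f y \<le> K" if "r < y" "y < r + d" "y \<le> t" for y
      using d[rule_format, of "y - r"] that r True by simp
    then show ?thesis using \<open>d > 0\<close> by blast
  next
    case False
    then have "f r < K" using below by simp
    then obtain d where "d > 0" and d: "\<forall>y\<in>{s..t}. dist y r < d \<longrightarrow> dist (f y) (f r) < K - f r"
      using cont r unfolding continuous_on_iff by (metis atLeastAtMost_iff diff_gt_0_iff_gt)
    have "f y \<le> K" if "r < y" "y < r + d" "y \<le> t" for y
    proof -
      have "dist (f y) (f r) < K - f r" using d that r by (auto simp: dist_real_def)
      then show ?thesis by (auto simp: dist_real_def)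
    qed
    then show ?thesis using \<open>d > 0\<close> by blast
  qed
  then obtain d where "d > 0" and d: "\<And>y. r < y \<Longrightarrow> y < r + d \<Longrightarrow> y \<le> t \<Longrightarrow> f y \<le> K" by blast
  have "r + d \<le> y" if "y \<in> A" for y
    using d[of y] that before below by (force simp: A_def not_le)
  then have "r + d \<le> r" unfolding r_def using x by (intro cInf_greatest) auto
  then show False using \<open>d > 0\<close> by simp
qed

section \<open>Parameter-dependent initial value problems and homotopies\<close>

text \<open>Picard iteration on bounded continuous functions of time and parameter jointly, so that
  continuity in the parameter comes with the fixed point. Both variables are retracted to
  \<open>{0..1}\<close> and \<open>P\<close> because these functions live on the whole type.\<close>

lemma ode_parameter_solution:
  fixes F :: "'p::euclidean_space \<Rightarrow> 'x::euclidean_space \<Rightarrow> 'x"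
  assumes P: "compact P" "convex P" "P \<noteq> {}"
    and cont: "continuous_on (P \<times> UNIV) (\<lambda>(p, x). F p x)"
    and lip: "\<And>p x y. p \<in> P \<Longrightarrow> norm (F p x - F p y) \<le> L * norm (x - y)"
  obtains X where "continuous_on (P \<times> {0..1}) (\<lambda>(p, t). X p t)"
    and "\<And>p. p \<in> P \<Longrightarrow> X p 0 = x0"
    and "\<And>p t. \<lbrakk>p \<in> P; t \<in> {0..1}\<rbrakk> \<Longrightarrow>
           (X p has_vector_derivative F p (X p t)) (at t within {0..1})"
proof -
  \<comment> \<open>The unknown will be \<open>exp (- K * t) *\<^sub>R X p t\<close>; with this
    weight the iteration contracts by 1/2 on all of \<open>{0..1}\<close>, however large
    \<open>L\<close> is.\<close>
  define K where "K = 2 * (\<bar>L\<bar> + 1)"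
  have "K > 0" by (simp add: K_def add_pos_nonneg)
  define pr where "pr = closest_point P"
  define cl where "cl t = max 0 (min 1 t)" for t :: real
  have closed: "closed P" using P by (simp add: compact_imp_closed)
  have pr: "pr p \<in> P" for p
    using P closed unfolding pr_def by (simp add: closest_point_in_set)
  have pr_id: "pr p = p" if "p \<in> P" for p
    using that unfolding pr_def by (rule closest_point_self)
  have pr_cont [continuous_intros]: "continuous_on S (\<lambda>x. pr (f x))"
    if "continuous_on S f" for S and f :: "'b::topological_space \<Rightarrow> 'p"
    using continuous_on_compose2[OF continuous_on_closest_point[OF P(2) closed P(3), of UNIV] that]
    by (simp add: pr_def)
  have cl: "cl t \<in> {0..1}" for t by (auto simp: cl_def)
  have cl_id: "cl t = t" if "t \<in> {0..1}" for t using that by (auto simp: cl_def)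
  have cl_cont: "continuous_on S cl" for S
    unfolding cl_def by (intro continuous_intros)
  \<comment> \<open>The integral over \<open>{0..t}\<close> is rescaled to \<open>{0..1}\<close>, so
    that its domain does not depend on the variables in which continuity is shown.\<close>
  define \<phi> where "\<phi> Y t p r = F (pr p) (exp (K * (t * r)) *\<^sub>R Y (t * r, p))"
    for Y :: "real \<times> 'p \<Rightarrow> 'x" and t p r
  define H where "H Y z = exp (- K * fst z) *\<^sub>R
      (x0 + fst z *\<^sub>R integral (cbox 0 1) (\<phi> Y (fst z) (snd z)))"
    for Y :: "real \<times> 'p \<Rightarrow> 'x" and z
  have F_cont: "continuous_on S (\<lambda>z. F (pr (f z)) (g z))"
    if "continuous_on S f" "continuous_on S g" for S f and g :: "'b::topological_space \<Rightarrow> 'x"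
  proof -
    have "continuous_on S (\<lambda>z. (pr (f z), g z))"
      by (intro continuous_intros that)
    then show ?thesis
      using continuous_on_compose2[OF cont, of S "\<lambda>z. (pr (f z), g z)"] pr by auto
  qed
  have \<phi>_cont: "continuous_on S (\<lambda>z. \<phi> (apply_bcontfun Y) (f z) (g z) (h z))"
    if "continuous_on S f" "continuous_on S g" "continuous_on S h"
    for S Y f g and h :: "'b::topological_space \<Rightarrow> real"
  proof -
    have "continuous_on S (\<lambda>z. apply_bcontfun Y (f z * h z, g z))"
      by (rule continuous_on_compose2[OF continuous_on_apply_bcontfun[of UNIV]])
        (auto intro!: continuous_intros that)
    then show ?thesis
      unfolding \<phi>_def by (intro F_cont continuous_intros that)
  qed
  have H_cont: "continuous_on UNIV (H (apply_bcontfun Y))" for Y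
  proof -
    have "continuous_on UNIV (\<lambda>z. integral (cbox 0 1) (\<phi> (apply_bcontfun Y) (fst z) (snd z)))"
      by (rule integral_continuous_on_param)
        (auto simp: split_beta intro!: \<phi>_cont continuous_intros)
    then show ?thesis unfolding H_def by (intro continuous_intros)
  qed
  have H_bcontfun: "(\<lambda>z. H (apply_bcontfun Y) (cl (fst z), pr (snd z))) \<in> bcontfun" for Y
  proof -
    have "compact (H (apply_bcontfun Y) ` ({0..1} \<times> P))"
      using P H_cont by (intro compact_continuous_image compact_Times)
        (auto intro: continuous_on_subset)
    then have "bounded (H (apply_bcontfun Y) ` ({0..1} \<times> P))"
      by (rule compact_imp_bounded)
    moreover have "range (\<lambda>z. H (apply_bcontfun Y) (cl (fst z), pr (snd z)))
        \<subseteq> H (apply_bcontfun Y) ` ({0..1} \<times> P)"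
      using cl pr by auto
    moreover have "continuous_on UNIV (\<lambda>z. H (apply_bcontfun Y) (cl (fst z), pr (snd z)))"
      by (rule continuous_on_compose2[OF H_cont])
        (auto intro!: continuous_intros continuous_on_compose2[OF cl_cont[of UNIV]])
    ultimately show ?thesis by (auto simp: bcontfun_def intro: bounded_subset)
  qed
  define T where "T Y = Bcontfun (\<lambda>z. H (apply_bcontfun Y) (cl (fst z), pr (snd z)))"
    for Y :: "(real \<times> 'p) \<Rightarrow>\<^sub>C 'x"
  have T: "apply_bcontfun (T Y) z = H (apply_bcontfun Y) (cl (fst z), pr (snd z))" for Y z
    unfolding T_def using Bcontfun_inverse[OF H_bcontfun[of Y]] by (rule fun_cong)
  have contraction: "dist (T Y) (T Z) \<le> 1/2 * dist Y Z" for Y Z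
  proof (rule dist_bound)
    fix z :: "real \<times> 'p"
    define t p D where "t = cl (fst z)" and "p = pr (snd z)" and "D = dist Y Z"
    have t: "0 \<le> t" "t \<le> 1" using cl[of "fst z"] by (auto simp: t_def)
    have D: "0 \<le> D" by (simp add: D_def)
    let ?y = "\<phi> (apply_bcontfun Y) t p" and ?z = "\<phi> (apply_bcontfun Z) t p"
    have int: "\<phi> (apply_bcontfun W) t p integrable_on cbox 0 1" for W
      by (rule integrable_continuous) (rule \<phi>_cont[OF continuous_on_const continuous_on_const continuous_on_id])
    have "((\<lambda>r. t * exp (K * (t * r))) has_integral exp (K * (t * 1)) / K - exp (K * (t * 0)) / K) {0..1}"
    proof (rule fundamental_theorem_of_calculus)
      fix r :: real
      show "((\<lambda>r. exp (K * (t * r)) / K) has_vector_derivative t * exp (K * (t * r))) (at r within {0..1})"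
        unfolding has_real_derivative_iff_has_vector_derivative[symmetric]
        using \<open>K > 0\<close> by (auto intro!: derivative_eq_intros)
    qed simp
    then have expint: "((\<lambda>r. \<bar>L\<bar> * D * (t * exp (K * (t * r)))) has_integral
        \<bar>L\<bar> * D * ((exp (K * t) - 1) / K)) (cbox 0 1)"
      by (intro has_integral_mult_right) (simp add: diff_divide_distrib)
    have "norm (integral (cbox 0 1) (\<lambda>r. t *\<^sub>R (?y r - ?z r)))
        \<le> integral (cbox 0 1) (\<lambda>r. \<bar>L\<bar> * D * (t * exp (K * (t * r))))"
    proof (rule Henstock_Kurzweil_Integration.integral_norm_bound_integral)
      show "(\<lambda>r. t *\<^sub>R (?y r - ?z r)) integrable_on cbox 0 1"
        by (intro integrable_cmul integrable_diff int)
      fix r :: real assume "r \<in> cbox 0 1"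
      have "norm (?y r - ?z r) \<le> L * norm (exp (K * (t * r)) *\<^sub>R Y (t * r, p) - exp (K * (t * r)) *\<^sub>R Z (t * r, p))"
        unfolding \<phi>_def by (rule lip[OF pr])
      also have "\<dots> = L * (exp (K * (t * r)) * dist (Y (t * r, p)) (Z (t * r, p)))"
        by (simp add: dist_norm flip: scaleR_diff_right)
      also have "\<dots> \<le> \<bar>L\<bar> * (exp (K * (t * r)) * D)"
        unfolding D_def by (intro mult_mono mult_left_mono dist_bounded) auto
      finally show "norm (t *\<^sub>R (?y r - ?z r)) \<le> \<bar>L\<bar> * D * (t * exp (K * (t * r)))"
        using mult_left_mono[of "norm (?y r - ?z r)" "\<bar>L\<bar> * (exp (K * (t * r)) * D)" t] t
        by (simp add: mult_ac flip: scaleR_diff_right)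
    qed (use expint in blast)
    also have "\<dots> = \<bar>L\<bar> * D * ((exp (K * t) - 1) / K)"
      by (rule integral_unique[OF expint])
    also have "\<dots> \<le> \<bar>L\<bar> * D * (exp (K * t) / K)"
      using D \<open>K > 0\<close> by (intro mult_left_mono divide_right_mono) auto
    also have "\<dots> \<le> 1/2 * D * exp (K * t)"
    proof -
      have "\<bar>L\<bar> / K \<le> 1/2" using \<open>K > 0\<close> by (simp add: K_def field_simps)
      then have "\<bar>L\<bar> / K * (D * exp (K * t)) \<le> 1/2 * (D * exp (K * t))"
        by (rule mult_right_mono) (use D in simp)
      then show ?thesis by (simp add: mult_ac)
    qed
    finally have bound: "norm (integral (cbox 0 1) (\<lambda>r. t *\<^sub>R (?y r - ?z r))) \<le> 1/2 * D * exp (K * t)" .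
    have "T Y z - T Z z = exp (- K * t) *\<^sub>R (t *\<^sub>R (integral (cbox 0 1) ?y - integral (cbox 0 1) ?z))"
      by (simp add: T H_def t_def p_def flip: scaleR_diff_right)
    also have "\<dots> = exp (- K * t) *\<^sub>R integral (cbox 0 1) (\<lambda>r. t *\<^sub>R (?y r - ?z r))"
      using int by (simp add: integral_diff)
    finally have "dist (T Y z) (T Z z) = exp (- K * t) * norm (integral (cbox 0 1) (\<lambda>r. t *\<^sub>R (?y r - ?z r)))"
      by (simp only: dist_norm norm_scaleR abs_exp_cancel)
    also have "\<dots> \<le> exp (- K * t) * (1/2 * D * exp (K * t))"
      by (rule mult_left_mono[OF bound]) simp
    also have "\<dots> = 1/2 * D" by (simp add: exp_minus field_simps)
    finally show "dist (T Y z) (T Z z) \<le> 1/2 * dist Y Z" by (simp add: D_def)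
  qed
  obtain Y where Y: "T Y = Y"
    using banach_fix_type[of "1/2" T] contraction by auto
  define X where "X p t = exp (K * t) *\<^sub>R Y (t, p)" for p t
  show ?thesis
  proof
    show "continuous_on (P \<times> {0..1}) (\<lambda>(p, t). X p t)"
      unfolding X_def split_beta
      by (intro continuous_intros continuous_on_compose2[OF continuous_on_apply_bcontfun[of UNIV]]) auto
    have X_eq: "X p t = x0 + integral {0..t} (\<lambda>s. F p (X p s))" if "p \<in> P" "t \<in> {0..1}" for p t
    proof -
      define \<psi> where "\<psi> s = F p (X p s)" for s
      have \<psi>_cont: "continuous_on S \<psi>" for S
      proof -
        have "continuous_on S (\<lambda>s. F (pr p) (X p s))"
          unfolding X_def
          by (intro F_cont continuous_intros continuous_on_compose2[OF continuous_on_apply_bcontfun[of UNIV]]) auto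
        then show ?thesis using \<open>p \<in> P\<close> by (simp add: pr_id \<psi>_def)
      qed
      \<comment> \<open>Undoes the rescaling by the chain rule, which also covers
        \<open>t = 0\<close>.\<close>
      have "((\<lambda>r. t *\<^sub>R \<psi> (t * r)) has_integral
          integral {0..t * 1} \<psi> - integral {0..t * 0} \<psi>) {0..1}"
      proof (rule fundamental_theorem_of_calculus)
        fix r :: real assume r: "r \<in> {0..1}"
        have img: "(*) t ` {0..1} \<subseteq> {0..t}" and "t * r \<in> {0..t}"
          using that r by (auto simp: mult_left_le)
        have "((\<lambda>u. integral {0..u} \<psi>) has_vector_derivative \<psi> (t * r)) (at (t * r) within {0..t})"
          by (rule integral_has_vector_derivative) (use \<psi>_cont \<open>t * r \<in> {0..t}\<close> in auto)
        then have "((\<lambda>u. integral {0..u} \<psi>) has_vector_derivative \<psi> (t * r)) (at (t * r) within (*) t ` {0..1})"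
          by (rule has_vector_derivative_within_subset[OF _ img])
        moreover have "((*) t has_vector_derivative t) (at r within {0..1})"
          by (auto intro!: derivative_eq_intros)
        ultimately have "((\<lambda>u. integral {0..u} \<psi>) \<circ> (*) t has_vector_derivative t *\<^sub>R \<psi> (t * r)) (at r within {0..1})"
          by (intro vector_diff_chain_within)
        then show "((\<lambda>r. integral {0..t * r} \<psi>) has_vector_derivative t *\<^sub>R \<psi> (t * r)) (at r within {0..1})"
          by (simp add: o_def)
      qed simp
      then have scale: "t *\<^sub>R integral {0..1} (\<lambda>r. \<psi> (t * r)) = integral {0..t} \<psi>"
        by (simp add: integral_unique flip: integral_cmul)
      have "Y (t, p) = H Y (t, p)"
        using T[of Y "(t, p)"] that by (simp add: Y cl_id pr_id)
      then have "X p t = x0 + t *\<^sub>R integral {0..1} (\<phi> Y t p)"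
        unfolding X_def H_def by (simp add: exp_minus)
      also have "\<phi> Y t p = (\<lambda>r. \<psi> (t * r))"
        using \<open>p \<in> P\<close> by (auto simp: \<phi>_def \<psi>_def X_def pr_id)
      finally show ?thesis by (simp only: scale) (simp only: \<psi>_def[abs_def])
    qed
    show "X p 0 = x0" if "p \<in> P" for p using X_eq[OF that, of 0] by simp
    show "(X p has_vector_derivative F p (X p t)) (at t within {0..1})" if "p \<in> P" "t \<in> {0..1}" for p t
    proof -
      have "continuous_on {0..1} (\<lambda>s. F (pr p) (X p s))"
        unfolding X_def
        by (intro F_cont continuous_intros continuous_on_compose2[OF continuous_on_apply_bcontfun[of UNIV]]) auto
      then have "continuous_on {0..1} (\<lambda>s. F p (X p s))" using that by (simp add: pr_id)
      from integral_has_vector_derivative[OF this \<open>t \<in> {0..1}\<close>]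
      have "((\<lambda>t. x0 + integral {0..t} (\<lambda>s. F p (X p s))) has_vector_derivative F p (X p t)) (at t within {0..1})"
        by (auto intro!: derivative_eq_intros)
      then show ?thesis
        by (rule has_vector_derivative_transform[OF \<open>t \<in> {0..1}\<close>, rotated]) (use X_eq that in auto)
    qed
  qed
qed

text \<open>Leray-Schauder continuation reduced to Brouwer by making the homotopy parameter a
  function of the point.\<close>

lemma homotopy_fixed_point:
  fixes \<Phi> :: "real \<Rightarrow> 'a::euclidean_space \<Rightarrow> 'a"
  assumes cont: "continuous_on ({0..1} \<times> cball 0 (B + 1)) (\<lambda>(l, c). \<Phi> l c)"
    and const: "\<And>c. norm c \<le> B + 1 \<Longrightarrow> \<Phi> 0 c = q"
    and "norm q \<le> B"
    and bound: "\<And>l c. \<lbrakk>0 \<le> l; l \<le> 1; norm c \<le> B + 1; \<Phi> l c = c\<rbrakk> \<Longrightarrow> norm c \<le> B"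
  obtains c where "norm c \<le> B" "\<Phi> 1 c = c"
proof -
  have "B \<ge> 0" using \<open>norm q \<le> B\<close> norm_ge_zero order_trans by blast
  define pr where "pr = closest_point (cball (0::'a) (B + 1))"
  have pr: "pr c \<in> cball 0 (B + 1)" for c
    unfolding pr_def using \<open>B \<ge> 0\<close> by (intro closest_point_in_set) auto
  have pr_id: "pr c = c" if "norm c \<le> B + 1" for c
    unfolding pr_def using that by (intro closest_point_self) auto
  \<comment> \<open>\<open>\<eta>\<close> is 1 on the ball of radius \<open>B\<close> and 0 outside
    radius \<open>B + 1\<close>. A fixed point of \<open>g\<close> outside the larger ball would
    equal \<open>q\<close>; one in the shell would be a fixed point of some \<open>\<Phi> l\<close>.
    Both contradict the bounds.\<close>
  define \<eta> where "\<eta> c = max 0 (min 1 (B + 1 - norm c))" for c :: 'a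
  have \<eta>: "\<eta> c \<in> {0..1}" for c by (auto simp: \<eta>_def)
  define g where "g c = \<Phi> (\<eta> c) (pr c)" for c
  have "continuous_on UNIV (\<lambda>c. (\<eta> c, pr c))"
    unfolding \<eta>_def pr_def using \<open>B \<ge> 0\<close>
    by (intro continuous_intros continuous_on_closest_point) auto
  then have g_cont: "continuous_on UNIV g"
    unfolding g_def
    using continuous_on_compose2[OF cont, of UNIV "\<lambda>c. (\<eta> c, pr c)"] \<eta> pr
    by (simp add: image_subset_iff del: mem_cball_0)
  have "compact ((\<lambda>(l, c). \<Phi> l c) ` ({0..1} \<times> cball 0 (B + 1)))"
    by (intro compact_continuous_image cont compact_Times) auto
  then obtain S where S: "\<And>z. z \<in> (\<lambda>(l, c). \<Phi> l c) ` ({0..1} \<times> cball 0 (B + 1)) \<Longrightarrow> norm z \<le> S"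
    by (meson bounded_iff compact_imp_bounded)
  have g_bound: "norm (g c) \<le> S" for c
  proof -
    have "(\<eta> c, pr c) \<in> {0..1} \<times> cball 0 (B + 1)"
      using \<eta> pr by blast
    then have "(\<lambda>(l, c). \<Phi> l c) (\<eta> c, pr c) \<in> (\<lambda>(l, c). \<Phi> l c) ` ({0..1} \<times> cball 0 (B + 1))"
      by (rule imageI)
    then show ?thesis using S by (simp add: g_def)
  qed
  then have "S \<ge> 0" using norm_ge_zero order_trans by blast
  then have "cball (0::'a) S \<noteq> {}" by simp
  moreover have "g \<in> cball 0 S \<rightarrow> cball 0 S" using g_bound by simp
  moreover have "continuous_on (cball 0 S) g" by (rule continuous_on_subset[OF g_cont]) simp
  ultimately obtain c where "g c = c"
    by (metis brouwer compact_cball convex_cball)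
  show thesis
  proof (cases "norm c \<le> B + 1")
    case True
    then have "\<Phi> (\<eta> c) c = c" using \<open>g c = c\<close> by (simp add: g_def pr_id)
    then have "norm c \<le> B" using bound[of "\<eta> c" c] \<eta>[of c] True by auto
    moreover from this have "\<eta> c = 1" by (simp add: \<eta>_def)
    ultimately show ?thesis using that \<open>\<Phi> (\<eta> c) c = c\<close> by simp
  next
    case False
    then have "\<eta> c = 0" by (simp add: \<eta>_def)
    then have "c = q" using \<open>g c = c\<close> const[of "pr c"] pr[of c] by (simp add: g_def)
    then show ?thesis using False \<open>norm q \<le> B\<close> by simp
  qed
qed

section \<open>A priori bounds\<close>

lemma energy_source_bound:
  fixes c w C M \<theta> :: real
  assumes "\<bar>c\<bar> \<le> C" "\<bar>w\<bar> \<le> M" "0 \<le> \<theta>" "\<theta> \<le> 1"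
  shows "\<bar>\<theta> * (c * w - w\<^sup>2 / 2)\<bar> \<le> C * M + M\<^sup>2 / 2"
proof -
  have "\<bar>c * w\<bar> \<le> C * M"
    using assms by (simp add: abs_mult mult_mono)
  moreover have "w\<^sup>2 \<le> M\<^sup>2" using assms by (simp add: abs_le_square_iff[symmetric])
  moreover have "0 \<le> w\<^sup>2" by simp
  ultimately have "\<bar>c * w - w\<^sup>2 / 2\<bar> \<le> C * M + M\<^sup>2 / 2" by linarith
  then have "\<bar>\<theta>\<bar> * \<bar>c * w - w\<^sup>2 / 2\<bar> \<le> 1 * (C * M + M\<^sup>2 / 2)"
    using assms by (intro mult_mono) auto
  then show ?thesis by (simp add: abs_mult)
qed

text \<open>The initial value of \<open>n * e + a * u\<^sup>2 / 2\<close>, amplified over the unit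
  interval at the growth rate found in \<open>c2_upper\<close>.\<close>

definition c2_bound :: "real \<Rightarrow> real \<Rightarrow> real \<Rightarrow> real \<Rightarrow> real \<Rightarrow> real" where
  "c2_bound a n G u\<^sub>0 e\<^sub>0 = (n * e\<^sub>0 + a * u\<^sub>0\<^sup>2 / 2) * exp ((1 + G) / n + 1 / a)"

text \<open>In \<open>c1_upper\<close> the summands make \<open>c\<^sub>1\<close> exceed
  \<open>u\<^sub>1\<close>, dominate the pressure where \<open>u = u\<^sub>1 / 2\<close> and
  \<open>e \<le> K + e\<^sub>1\<close>, and push the slope of \<open>e\<close> above
  \<open>e\<^sub>1\<close>.\<close>

definition c1_bound :: "real \<Rightarrow> real \<Rightarrow> real \<Rightarrow> real \<Rightarrow> real \<Rightarrow> real \<Rightarrow> real \<Rightarrow> real" where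
  "c1_bound a n G u\<^sub>0 e\<^sub>0 u\<^sub>1 e\<^sub>1 =
     (let K = c2_bound a n G u\<^sub>0 e\<^sub>0 in u\<^sub>1 + 2 * G * (K + e\<^sub>1) / u\<^sub>1 + 4 * (K + n * e\<^sub>1) / u\<^sub>1)"

text \<open>These estimates use only the sign of the pressure. They thus apply before the truncation
  of \<open>e\<close> at \<open>N\<close> is removed as well as after.\<close>

locale velocity =
  fixes a c\<^sub>1 u\<^sub>0 u\<^sub>1 :: real and p u :: "real \<Rightarrow> real"
  assumes a: "a > 0" and u_data: "u\<^sub>0 > 0" "u\<^sub>1 > 0"
    and p_nonneg: "\<And>t. p t \<ge> 0"
    and du: "\<And>t. t \<in> {0..1} \<Longrightarrow> (u has_real_derivative (u t - c\<^sub>1 + p t) / a) (at t within {0..1})"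
    and u_bc: "u 0 = u\<^sub>0" "u 1 = u\<^sub>1"
begin

lemma du_sub:
  assumes "x \<in> {s..t}" "0 \<le> s" "t \<le> 1"
  shows "(u has_real_derivative (u x - c\<^sub>1 + p x) / a) (at x within {s..t})"
  by (rule DERIV_subset[OF du]) (use assms in auto)

lemma u_growth:
  assumes "0 \<le> s" "s \<le> t" "t \<le> 1"
  shows "u t - c\<^sub>1 \<ge> (u s - c\<^sub>1) * exp (1 / a * (t - s))"
proof (rule exponential_growth[OF \<open>s \<le> t\<close>])
  show "(u has_real_derivative (u x - c\<^sub>1 + p x) / a) (at x within {s..t})"
    if "x \<in> {s..t}" for x using that assms by (intro du_sub)
  show "1 / a * (u x - c\<^sub>1) \<le> (u x - c\<^sub>1 + p x) / a" for x
    using p_nonneg[of x] a by (simp add: divide_right_mono)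
qed

text \<open>Used in both directions: a velocity above \<open>c\<^sub>1\<close> stays there, and a
  velocity below \<open>c\<^sub>1\<close> was below it at all earlier points.\<close>

lemma u_persist:
  assumes "0 \<le> s" "s \<le> t" "t \<le> 1" "u s \<ge> c\<^sub>1"
  shows "u t \<ge> u s"
proof -
  have "(u s - c\<^sub>1) * 1 \<le> (u s - c\<^sub>1) * exp (1 / a * (t - s))"
    by (rule mult_left_mono) (use assms a in auto)
  also have "\<dots> \<le> u t - c\<^sub>1" by (rule u_growth[OF assms(1-3)])
  finally show ?thesis by simp
qed

lemma u_upper: "t \<in> {0..1} \<Longrightarrow> u t \<le> max c\<^sub>1 u\<^sub>1"
  using u_persist[of t 1] u_bc by (cases "u t \<ge> c\<^sub>1") auto

lemma u_lower:
  assumes "t \<in> {0..1}"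
  shows "u t \<ge> c\<^sub>1 - (u\<^sub>0 + \<bar>c\<^sub>1\<bar>) * exp (1 / a)"
proof -
  have "- ((u\<^sub>0 + \<bar>c\<^sub>1\<bar>) * exp (1 / a)) \<le> - (\<bar>u\<^sub>0 - c\<^sub>1\<bar> * exp (1 / a * t))"
    using assms a u_data by (intro le_imp_neg_le mult_mono) (auto simp: field_simps)
  also have "\<dots> \<le> (u\<^sub>0 - c\<^sub>1) * exp (1 / a * t)"
    using abs_ge_minus_self[of "(u\<^sub>0 - c\<^sub>1) * exp (1 / a * t)"] by (simp add: abs_mult)
  also have "\<dots> \<le> u t - c\<^sub>1" using u_growth[of 0 t] assms u_bc by simp
  finally show ?thesis by simp
qed

lemma u_abs:
  assumes "t \<in> {0..1}" "\<bar>c\<^sub>1\<bar> \<le> C"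
  shows "\<bar>u t\<bar> \<le> C + u\<^sub>1 + (u\<^sub>0 + C) * exp (1 / a)"
proof -
  have "(u\<^sub>0 + \<bar>c\<^sub>1\<bar>) * exp (1 / a) \<le> (u\<^sub>0 + C) * exp (1 / a)"
    using assms by (intro mult_right_mono) auto
  moreover have "0 \<le> (u\<^sub>0 + \<bar>c\<^sub>1\<bar>) * exp (1 / a)" using u_data by simp
  ultimately show ?thesis using u_upper[OF assms(1)] u_lower[OF assms(1)] assms(2) u_data by linarith
qed

text \<open>A negative \<open>c\<^sub>1\<close> makes \<open>u\<close> gain at least
  \<open>- c\<^sub>1 / a\<close> over the unit interval, while it has to end at
  \<open>u\<^sub>1\<close>.\<close>

lemma c1_lower: "c\<^sub>1 \<ge> - (a * u\<^sub>1)"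
proof (cases "c\<^sub>1 < 0")
  case True
  have "(u\<^sub>0 - c\<^sub>1) * (1 + 1 / a) \<le> (u\<^sub>0 - c\<^sub>1) * exp (1 / a)"
    using True u_data by (intro mult_left_mono exp_ge_add_one_self) auto
  also have "\<dots> \<le> u\<^sub>1 - c\<^sub>1" using u_growth[of 0 1] u_bc by simp
  finally have "u\<^sub>0 + (u\<^sub>0 - c\<^sub>1) / a \<le> u\<^sub>1" by (simp add: algebra_simps)
  moreover have "- c\<^sub>1 / a \<le> (u\<^sub>0 - c\<^sub>1) / a" using a u_data by (intro divide_right_mono) auto
  ultimately have "- c\<^sub>1 / a \<le> u\<^sub>1" using u_data by linarith
  then show ?thesis using a by (simp add: field_simps)
qed (use a u_data in \<open>simp add: not_less order_trans[of _ 0]\<close>)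

end

text \<open>The boundary value problem at a fixed stage of the deformation: \<open>g\<close> scales
  the pressure, \<open>\<theta>\<close> the energy source. Only the cut-offs of \<open>e\<close> at
  0 and of \<open>u\<close> at \<open>\<delta>\<close> are left.\<close>

locale regularized_bvp =
  fixes a n g \<theta> \<delta> c\<^sub>1 c\<^sub>2 u\<^sub>0 e\<^sub>0 u\<^sub>1 e\<^sub>1 :: real and u e :: "real \<Rightarrow> real"
  assumes a_pos: "a > 0" and n: "n > 0" and \<delta>: "\<delta> > 0" and g: "g \<ge> 0" and \<theta>: "0 \<le> \<theta>" "\<theta> \<le> 1"
    and data: "u\<^sub>0 > 0" "e\<^sub>0 > 0" "u\<^sub>1 > 0" "e\<^sub>1 > 0"
    and deriv_u: "\<And>t. t \<in> {0..1} \<Longrightarrow>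
      (u has_real_derivative (u t - c\<^sub>1 + g * (max 0 (e t) / max (u t) \<delta>)) / a) (at t within {0..1})"
    and de: "\<And>t. t \<in> {0..1} \<Longrightarrow>
      (e has_real_derivative (e t - c\<^sub>2 + \<theta> * (c\<^sub>1 * u t - (u t)\<^sup>2 / 2)) / n) (at t within {0..1})"
    and bc: "u 0 = u\<^sub>0" "e 0 = e\<^sub>0" "u 1 = u\<^sub>1" "e 1 = e\<^sub>1"
begin

lemma pressure_nonneg: "g * (max 0 (e t) / max (u t) \<delta>) \<ge> 0"
  using g \<delta> by (intro mult_nonneg_nonneg divide_nonneg_nonneg) auto

sublocale velocity a c\<^sub>1 u\<^sub>0 u\<^sub>1 "\<lambda>t. g * (max 0 (e t) / max (u t) \<delta>)" u
  by unfold_locales (use a_pos data pressure_nonneg deriv_u bc in auto)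

lemma de_sub:
  assumes "x \<in> {s..t}" "0 \<le> s" "t \<le> 1"
  shows "(e has_real_derivative (e x - c\<^sub>2 + \<theta> * (c\<^sub>1 * u x - (u x)\<^sup>2 / 2)) / n) (at x within {s..t})"
  by (rule DERIV_subset[OF de]) (use assms in auto)

text \<open>The equation for \<open>u\<close> is then linear and decoupled from \<open>e\<close>, so
  \<open>u\<^sub>1 > 0\<close> alone limits \<open>c\<^sub>1\<close>.\<close>

lemma c1_no_pressure:
  assumes "g = 0"
  shows "c\<^sub>1 \<le> a * u\<^sub>0 * exp (1 / a)"
proof (cases "c\<^sub>1 > 0")
  case True
  have "u 1 - c\<^sub>1 \<le> (u 0 - c\<^sub>1) * exp (1 / a * (1 - 0))"
    by (rule exponential_growth_upper[OF _ du]) (auto simp: assms)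
  then have "c\<^sub>1 * (exp (1 / a) - 1) \<le> u\<^sub>0 * exp (1 / a)"
    using bc data by (simp add: algebra_simps)
  moreover have "1 / a \<le> exp (1 / a) - 1" using exp_ge_add_one_self[of "1 / a"] by linarith
  then have "c\<^sub>1 * (1 / a) \<le> c\<^sub>1 * (exp (1 / a) - 1)"
    using True by (intro mult_left_mono) auto
  ultimately have "c\<^sub>1 / a \<le> u\<^sub>0 * exp (1 / a)" by simp
  then show ?thesis using a by (simp add: divide_le_eq mult_ac)
next
  case False
  have "0 \<le> a * u\<^sub>0 * exp (1 / a)" using a data by simp
  then show ?thesis using False by linarith
qed

text \<open>At an interior minimum \<open>m\<close> of \<open>e\<close> the energy equation becomes \<open>n e' = (e - e m) - Q\<close> with
  \<open>2 Q = (u - c\<^sub>1)\<^sup>2 - (u m - c\<^sub>1)\<^sup>2\<close>. If \<open>u m \<ge> c\<^sub>1\<close>, then \<open>Q \<ge> 0\<close> to the right of \<open>m\<close>, so \<open>e\<close> never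
  exceeds \<open>e m\<close> there. Otherwise, if \<open>e m \<le> 0\<close>, then \<open>Q' \<ge> - C (e - e m)\<close> to the left of \<open>m\<close>, and a
  Gronwall argument forces \<open>e\<close> to stay at \<open>e m\<close> there.\<close>

lemma e_pos:
  assumes "\<theta> = 1" "t \<in> {0..1}"
  shows "e t > 0"
proof -
  have "continuous_on {0..1} e" by (rule DERIV_continuous_on[OF de])
  then obtain m where m: "m \<in> {0..1}" and min: "\<And>x. x \<in> {0..1} \<Longrightarrow> e m \<le> e x"
    using continuous_attains_inf[of "{0..1::real}" e] by auto
  have "e m > 0"
  proof (rule ccontr)
    assume "\<not> e m > 0"
    then have m01: "0 < m" "m < 1" using bc data m by (auto simp: order_le_less)
    have "DERIV e m :> (e m - c\<^sub>2 + \<theta> * (c\<^sub>1 * u m - (u m)\<^sup>2 / 2)) / n"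
      using de[OF m] m01 by (simp add: at_within_Icc_at)
    moreover have "0 < min m (1 - m)" using m01 by simp
    moreover have "\<forall>y. \<bar>m - y\<bar> < min m (1 - m) \<longrightarrow> e m \<le> e y"
      using min by (auto simp: abs_if split: if_splits)
    ultimately have "(e m - c\<^sub>2 + \<theta> * (c\<^sub>1 * u m - (u m)\<^sup>2 / 2)) / n = 0"
      by (rule DERIV_local_min)
    then have c2: "c\<^sub>2 = e m + c\<^sub>1 * u m - (u m)\<^sup>2 / 2" using n \<open>\<theta> = 1\<close> by simp
    define Q where "Q x = ((u x - c\<^sub>1)\<^sup>2 - (u m - c\<^sub>1)\<^sup>2) / 2" for x
    have de': "(e x - c\<^sub>2 + \<theta> * (c\<^sub>1 * u x - (u x)\<^sup>2 / 2)) / n = (e x - e m - Q x) / n" for x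
    proof -
      have "e x - c\<^sub>2 + \<theta> * (c\<^sub>1 * u x - (u x)\<^sup>2 / 2) = e x - e m - Q x"
        unfolding c2 Q_def \<open>\<theta> = 1\<close> by (simp add: power2_eq_square field_simps)
      then show ?thesis by simp
    qed
    show False
    proof (cases "u m \<ge> c\<^sub>1")
      case True
      have "e 1 - e m \<le> (e m - e m) * exp (1 / n * (1 - m))"
      proof (rule exponential_growth_upper)
        fix x assume x: "x \<in> {m..1}"
        show "(e has_real_derivative (e x - e m - Q x) / n) (at x within {m..1})"
          using de_sub[OF x] m01 by (simp add: de')
        have "(u m - c\<^sub>1)\<^sup>2 \<le> (u x - c\<^sub>1)\<^sup>2"
          by (rule power_mono) (use u_persist[of m x] True x m01 in auto)
        then show "(e x - e m - Q x) / n \<le> 1 / n * (e x - e m)"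
          using n by (simp add: Q_def divide_right_mono)
      qed (use m01 in simp)
      then show False using bc data \<open>\<not> e m > 0\<close> by simp
    next
      case False
      have below: "u x < c\<^sub>1" if "0 \<le> x" "x \<le> m" for x
        using u_persist[of x m] that False m01 by force
      \<comment> \<open>\<open>Y\<close> bounds \<open>c\<^sub>1 - u\<close>, and
        \<open>C * E\<close> bounds the pressure contribution to \<open>Q'\<close>. The choice of
        \<open>\<mu>\<close> ensures \<open>C + \<mu> \<le> \<mu> * \<mu> * n\<close>, which makes
        \<open>Q - \<mu> * n * E\<close> grow at rate \<open>\<mu>\<close>.\<close>
      define Y C \<mu> where "Y = (u\<^sub>0 + \<bar>c\<^sub>1\<bar>) * exp (1 / a)"
        and "C = Y * (g / \<delta>) / a" and "\<mu> = (1 + C) / n + 1"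
      have "Y \<ge> 0" using data by (simp add: Y_def)
      then have "C \<ge> 0" using a g \<delta> by (simp add: C_def)
      have \<mu>: "C + \<mu> \<le> \<mu> * \<mu> * n"
      proof -
        have "\<mu> \<ge> 1" using \<open>C \<ge> 0\<close> n by (simp add: \<mu>_def)
        have "\<mu> * n = 1 + C + n" using n by (simp add: \<mu>_def field_simps)
        then have "\<mu> * (\<mu> * n) = \<mu> + \<mu> * C + \<mu> * n" by (simp add: algebra_simps)
        moreover have "1 * C \<le> \<mu> * C" by (rule mult_right_mono) fact+
        moreover have "0 \<le> \<mu> * n" using \<open>\<mu> \<ge> 1\<close> n by simp
        ultimately show ?thesis by (simp add: mult.assoc)
      qed
      define E where "E x = e x - e m" for x
      have E: "E x \<ge> 0" if "0 \<le> x" "x \<le> m" for x using min[of x] that m01 by (simp add: E_def)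
      have dE: "(E has_real_derivative (E x - Q x) / n) (at x within {s..m})"
        if "x \<in> {s..m}" "0 \<le> s" for x s
        unfolding E_def using de_sub[OF that] m01 that
        by (auto intro!: derivative_eq_intros simp: de')
      have Q_le: "Q x \<le> \<mu> * n * E x" if "0 \<le> x" "x \<le> m" for x
      proof -
        \<comment> \<open>\<open>Q\<close> and \<open>E\<close> both vanish at \<open>m\<close>, so
          a positive value of \<open>Q - \<mu> * n * E\<close> further left could not have grown on
          the way to \<open>m\<close>.\<close>
        have "(Q m - \<mu> * n * E m) - 0 \<ge> ((Q x - \<mu> * n * E x) - 0) * exp (\<mu> * (m - x))"
        proof (rule exponential_growth)
          fix z assume z: "z \<in> {x..m}"
          let ?p = "g * (max 0 (e z) / max (u z) \<delta>)"
          have z': "0 \<le> z" "z \<le> m" using z that by auto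
          show "((\<lambda>x. Q x - \<mu> * n * E x) has_real_derivative
              (u z - c\<^sub>1) * ((u z - c\<^sub>1 + ?p) / a) - \<mu> * (E z - Q z)) (at z within {x..m})"
            unfolding Q_def
            by (rule derivative_eq_intros du_sub[OF z] dE[OF z] refl | use n m01 that in \<open>simp add: Q_def\<close>)+
          have "c\<^sub>1 - u z \<le> Y" using u_lower[of z] z' m01 by (simp add: Y_def)
          \<comment> \<open>Here \<open>e m \<le> 0\<close> is essential: it gives
            \<open>max 0 (e z) \<le> E z\<close>, so the pressure is controlled by
            \<open>E\<close>.\<close>
          moreover have "?p \<le> g * (E z / \<delta>)"
            using \<open>\<not> e m > 0\<close> \<delta> g E[OF z'] by (intro mult_left_mono frac_le) (auto simp: E_def)
          ultimately have "(c\<^sub>1 - u z) * ?p \<le> Y * (g * (E z / \<delta>))"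
            by (rule mult_mono) (use \<open>Y \<ge> 0\<close> pressure_nonneg[of z] in auto)
          then have "(c\<^sub>1 - u z) * ?p / a \<le> Y * (g * (E z / \<delta>)) / a"
            using a by (intro divide_right_mono) auto
          also have "\<dots> = C * E z" by (simp add: C_def)
          finally have "(u z - c\<^sub>1) * ((u z - c\<^sub>1 + ?p) / a) \<ge> (u z - c\<^sub>1)\<^sup>2 / a - C * E z"
            by (simp add: power2_eq_square add_divide_distrib diff_divide_distrib algebra_simps)
          moreover have "(u z - c\<^sub>1)\<^sup>2 / a \<ge> 0" using a by simp
          moreover have "(C + \<mu>) * E z \<le> \<mu> * \<mu> * n * E z" by (rule mult_right_mono[OF \<mu> E[OF z']])
          ultimately show "\<mu> * (Q z - \<mu> * n * E z - 0) \<le>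
              (u z - c\<^sub>1) * ((u z - c\<^sub>1 + ?p) / a) - \<mu> * (E z - Q z)"
            by (simp add: algebra_simps)
        qed (use that in simp)
        then have "(Q x - \<mu> * n * E x) * exp (\<mu> * (m - x)) \<le> 0" by (simp add: Q_def E_def)
        then show ?thesis by (simp add: mult_le_0_iff)
      qed
      \<comment> \<open>With \<open>Q \<le> \<mu> * n * E\<close>, the function \<open>E\<close>
        decays at most exponentially; \<open>E 0 > 0\<close> would leave
        \<open>E m > 0\<close>.\<close>
      have "E m - 0 \<ge> (E 0 - 0) * exp ((1 - \<mu> * n) / n * (m - 0))"
      proof (rule exponential_growth)
        fix x assume x: "x \<in> {0..m}"
        show "(E has_real_derivative (E x - Q x) / n) (at x within {0..m})" using dE x by simp
        have "(E x - \<mu> * n * E x) / n \<le> (E x - Q x) / n"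
          using Q_le x n by (intro divide_right_mono) auto
        then show "(1 - \<mu> * n) / n * (E x - 0) \<le> (E x - Q x) / n"
          using n by (simp add: field_simps)
      qed (use m01 in simp)
      then have "E 0 \<le> 0" by (simp add: E_def mult_le_0_iff)
      then show False using bc data \<open>\<not> e m > 0\<close> by (simp add: E_def)
    qed
  qed
  then show ?thesis using min[OF \<open>t \<in> {0..1}\<close>] by linarith
qed

text \<open>The terms containing \<open>c\<^sub>1\<close> cancel in the growth of the energy \<open>n e + a u\<^sup>2 / 2\<close>, which makes the
  bound independent of \<open>c\<^sub>1\<close>.\<close>

lemma c2_upper:
  assumes "\<theta> = 1" "g \<le> G"
  shows "c\<^sub>2 \<le> c2_bound a n G u\<^sub>0 e\<^sub>0"
proof (cases "c\<^sub>2 > 0")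
  case True
  define C E where "C = (1 + G) / n + 1 / a" and "E x = n * e x + a * (u x)\<^sup>2 / 2" for x
  have "C > 0" using assms g n a by (simp add: C_def add_pos_pos)
  \<comment> \<open>The sink \<open>c\<^sub>2\<close> is absorbed into the reference level
    \<open>c\<^sub>2 / C\<close>. A large \<open>c\<^sub>2\<close> would drive \<open>E\<close>
    below zero at the right end.\<close>
  have "E 1 - c\<^sub>2 / C \<le> (E 0 - c\<^sub>2 / C) * exp (C * (1 - 0))"
  proof (rule exponential_growth_upper)
    fix x :: real assume x: "x \<in> {0..1}"
    let ?p = "g * (max 0 (e x) / max (u x) \<delta>)"
    have e: "e x > 0" by (rule e_pos) fact+
    show "(E has_real_derivative (e x - c\<^sub>2 + (c\<^sub>1 * u x - (u x)\<^sup>2 / 2)) + u x * (u x - c\<^sub>1 + ?p))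
        (at x within {0..1})"
      unfolding E_def
      by (rule derivative_eq_intros du[OF x] de[OF x] refl | use n a in \<open>simp add: \<open>\<theta> = 1\<close>\<close>)+
    \<comment> \<open>The factor \<open>u\<close> cancels the denominator of the pressure, which
      keeps the bound free of \<open>\<delta>\<close>.\<close>
    have "u x * ?p \<le> max (u x) \<delta> * ?p"
      by (rule mult_right_mono) (use pressure_nonneg in auto)
    also have "\<dots> = g * e x" using \<delta> e by (simp add: max_def)
    also have "\<dots> \<le> G * e x" using assms e by (intro mult_right_mono) auto
    finally have "(e x - c\<^sub>2 + (c\<^sub>1 * u x - (u x)\<^sup>2 / 2)) + u x * (u x - c\<^sub>1 + ?p)
        \<le> (1 + G) * e x + (u x)\<^sup>2 / 2 - c\<^sub>2"
      by (simp add: algebra_simps power2_eq_square)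
    also have "\<dots> \<le> C * E x - c\<^sub>2"
    proof -
      have "C * E x = (1 + G) * e x + (u x)\<^sup>2 / 2 + (n * e x / a + (1 + G) * a * (u x)\<^sup>2 / (2 * n))"
        using a n by (simp add: C_def E_def field_simps)
      moreover have "0 \<le> n * e x / a + (1 + G) * a * (u x)\<^sup>2 / (2 * n)"
        using a n e assms g by (intro add_nonneg_nonneg divide_nonneg_nonneg mult_nonneg_nonneg) auto
      ultimately show ?thesis by linarith
    qed
    also have "\<dots> = C * (E x - c\<^sub>2 / C)" using \<open>C > 0\<close> by (simp add: algebra_simps)
    finally show "(e x - c\<^sub>2 + (c\<^sub>1 * u x - (u x)\<^sup>2 / 2)) + u x * (u x - c\<^sub>1 + ?p) \<le> C * (E x - c\<^sub>2 / C)" .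
  qed simp
  moreover have "E 1 \<ge> 0" using bc data a n by (simp add: E_def)
  ultimately have "c\<^sub>2 / C * (exp C - 1) \<le> E 0 * exp C" by (simp add: algebra_simps)
  moreover have "C \<le> exp C - 1" using exp_ge_add_one_self[of C] by linarith
  then have "c\<^sub>2 / C * C \<le> c\<^sub>2 / C * (exp C - 1)"
    using True \<open>C > 0\<close> by (intro mult_left_mono) auto
  ultimately show ?thesis using \<open>C > 0\<close> bc by (simp add: c2_bound_def E_def C_def)
next
  case False
  have "c2_bound a n G u\<^sub>0 e\<^sub>0 \<ge> 0" using a n data by (simp add: c2_bound_def)
  then show ?thesis using False by linarith
qed

text \<open>For large \<open>c\<^sub>1\<close> the velocity cannot drop below \<open>u\<^sub>1 / 2\<close> anywhere, as it would decrease from there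
  on; but then \<open>e\<close> increases too fast to end at \<open>e\<^sub>1\<close>.\<close>

lemma c1_upper:
  assumes "\<theta> = 1" "g \<le> G" "\<delta> \<le> u\<^sub>1 / 2"
  shows "c\<^sub>1 \<le> c1_bound a n G u\<^sub>0 e\<^sub>0 u\<^sub>1 e\<^sub>1"
proof (rule ccontr)
  define K where "K = c2_bound a n G u\<^sub>0 e\<^sub>0"
  assume "\<not> c\<^sub>1 \<le> c1_bound a n G u\<^sub>0 e\<^sub>0 u\<^sub>1 e\<^sub>1"
  then have c1: "c\<^sub>1 > u\<^sub>1 + 2 * G * (K + e\<^sub>1) / u\<^sub>1 + 4 * (K + n * e\<^sub>1) / u\<^sub>1"
    by (simp add: c1_bound_def K_def Let_def)
  have "K \<ge> 0" using a n data by (simp add: c2_bound_def K_def)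
  have "G \<ge> 0" using g assms by linarith
  have c2: "c\<^sub>2 \<le> K" unfolding K_def by (rule c2_upper) fact+
  have pos: "2 * G * (K + e\<^sub>1) / u\<^sub>1 \<ge> 0" "4 * (K + n * e\<^sub>1) / u\<^sub>1 \<ge> 0"
    using \<open>K \<ge> 0\<close> \<open>G \<ge> 0\<close> data n by auto
  have u_le: "u x \<le> c\<^sub>1" if "x \<in> {0..1}" for x
    using u_upper[OF that] c1 pos by linarith
  have source: "c\<^sub>1 * u x - (u x)\<^sup>2 / 2 \<ge> c\<^sub>1 * u x / 2" if "x \<in> {0..1}" "u x \<ge> 0" for x
    using mult_right_mono[OF u_le[OF that(1)] that(2)] by (simp add: power2_eq_square)
  \<comment> \<open>The barrier is run from the right end, where \<open>u = u\<^sub>1\<close> lies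
    above \<open>u\<^sub>1 / 2\<close>; hence the reflection of the interval.\<close>
  have "- u (1 - x) \<le> - (u\<^sub>1 / 2)" if "x \<in> {0..1}" for x
  proof (rule stay_below[OF _ _ _ _ that])
    show "((\<lambda>x. - u (1 - x)) has_real_derivative
        (u (1 - x) - c\<^sub>1 + g * (max 0 (e (1 - x)) / max (u (1 - x)) \<delta>)) / a) (at x within {0..1})"
      if "x \<in> {0..1}" for x
    proof -
      have "(\<lambda>x::real. 1 - x) ` {0..1} = {0..1}" by (auto simp: image_iff intro!: bexI[of _ "1 - _"])
      then have "(u has_real_derivative (u (1 - x) - c\<^sub>1 + g * (max 0 (e (1 - x)) / max (u (1 - x)) \<delta>)) / a)
          (at (1 - x) within (\<lambda>x. 1 - x) ` {0..1})"
        using du[of "1 - x"] that by simp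
      then have "((\<lambda>x. u (1 - x)) has_real_derivative
          (u (1 - x) - c\<^sub>1 + g * (max 0 (e (1 - x)) / max (u (1 - x)) \<delta>)) / a * - 1) (at x within {0..1})"
        by (rule DERIV_image_chain[unfolded o_def]) (auto intro!: derivative_eq_intros)
      then show ?thesis by (auto dest: DERIV_minus)
    qed
    fix r :: real
    assume r: "0 \<le> r" "r \<le> 1" "- u (1 - r) = - (u\<^sub>1 / 2)"
      and ge: "\<And>x. \<lbrakk>0 \<le> x; x \<le> r\<rbrakk> \<Longrightarrow> - u (1 - x) \<le> - (u\<^sub>1 / 2)"
    \<comment> \<open>To the right of the contact point the source is nonnegative, so an energy
      above \<open>K\<close> could only grow before reaching \<open>e\<^sub>1\<close>. This caps the
      pressure at the contact.\<close>
    have "e 1 - K \<ge> (e (1 - r) - K) * exp (1 / n * (1 - (1 - r)))"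
    proof (rule exponential_growth[OF _ de_sub])
      fix x assume x: "x \<in> {1 - r..1}"
      have "u x \<ge> u\<^sub>1 / 2" using ge[of "1 - x"] x by simp
      then have "c\<^sub>1 * u x - (u x)\<^sup>2 / 2 \<ge> 0"
        using source[of x] x r u_le[of x] data by (smt (verit) atLeastAtMost_iff divide_nonneg_nonneg mult_nonneg_nonneg)
      then show "1 / n * (e x - K) \<le> (e x - c\<^sub>2 + \<theta> * (c\<^sub>1 * u x - (u x)\<^sup>2 / 2)) / n"
        using n c2 \<open>\<theta> = 1\<close> by (simp add: divide_right_mono)
    qed (use r in auto)
    moreover have "(e (1 - r) - K) * 1 \<le> (e (1 - r) - K) * exp (1 / n * (1 - (1 - r)))" if "e (1 - r) \<ge> K"
      using that r n by (intro mult_left_mono) auto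
    ultimately have "e (1 - r) \<le> K + e\<^sub>1"
      using bc \<open>K \<ge> 0\<close> data by (cases "e (1 - r) \<ge> K") auto
    moreover have "e (1 - r) > 0" using e_pos[OF \<open>\<theta> = 1\<close>] r by simp
    ultimately have "g * (max 0 (e (1 - r)) / max (u (1 - r)) \<delta>) \<le> G * ((K + e\<^sub>1) / (u\<^sub>1 / 2))"
      using assms g data r(3) \<open>G \<ge> 0\<close> by (intro mult_mono frac_le) auto
    then have "u (1 - r) - c\<^sub>1 + g * (max 0 (e (1 - r)) / max (u (1 - r)) \<delta>) < 0"
      using c1 pos r(3) data by (simp add: algebra_simps)
    then show "(u (1 - r) - c\<^sub>1 + g * (max 0 (e (1 - r)) / max (u (1 - r)) \<delta>)) / a < 0"
      using a by (simp add: divide_neg_pos)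
  qed (use bc data in auto)
  from this[of "1 - x" for x] have u_ge: "u x \<ge> u\<^sub>1 / 2" if "x \<in> {0..1}" for x
    using that by simp
  \<comment> \<open>A lower bound for the slope of \<open>e\<close>: the source is at least
    \<open>c\<^sub>1 * u / 2\<close> with \<open>u \<ge> u\<^sub>1 / 2\<close>, and
    \<open>c\<^sub>2 \<le> K\<close>.\<close>
  define k where "k = (c\<^sub>1 * u\<^sub>1 / 4 - K) / n"
  have "e 0 - k * 0 \<le> e 1 - k * 1"
  proof (rule nondecreasing_within[where f = "\<lambda>x. e x - k * x"])
    fix x :: real assume x: "x \<in> {0..1}"
    show "((\<lambda>x. e x - k * x) has_real_derivative
        (e x - c\<^sub>2 + \<theta> * (c\<^sub>1 * u x - (u x)\<^sup>2 / 2)) / n - k) (at x within {0..1})"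
      by (rule derivative_eq_intros de[OF x] refl | simp)+
    have "c\<^sub>1 * (u\<^sub>1 / 2) \<le> c\<^sub>1 * u x"
      using u_ge[OF x] u_le[OF x] data by (intro mult_left_mono) auto
    then have "c\<^sub>1 * u\<^sub>1 / 4 - K \<le> e x - c\<^sub>2 + \<theta> * (c\<^sub>1 * u x - (u x)\<^sup>2 / 2)"
      using source[OF x] u_ge[OF x] c2 e_pos[OF \<open>\<theta> = 1\<close> x] \<open>\<theta> = 1\<close> data by simp
    then show "0 \<le> (e x - c\<^sub>2 + \<theta> * (c\<^sub>1 * u x - (u x)\<^sup>2 / 2)) / n - k"
      unfolding k_def using n by (simp add: divide_right_mono)
  qed simp
  then have "k \<le> e\<^sub>1 - e\<^sub>0" using bc by simp
  moreover have "4 * (K + n * e\<^sub>1) / u\<^sub>1 < c\<^sub>1" using c1 pos data by linarith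
  then have "4 * (K + n * e\<^sub>1) < c\<^sub>1 * u\<^sub>1" using data by (simp add: divide_less_eq)
  then have "e\<^sub>1 < k" using n by (simp add: k_def less_divide_eq algebra_simps)
  ultimately show False using data by simp
qed

text \<open>Only the size of the source enters, so this holds for every \<open>\<theta>\<close>, at
  the price of depending on bounds for \<open>u\<close> and \<open>c\<^sub>1\<close>.\<close>

lemma c2_abs:
  assumes M: "\<And>t. t \<in> {0..1} \<Longrightarrow> \<bar>u t\<bar> \<le> M" and C: "\<bar>c\<^sub>1\<bar> \<le> C"
  shows "\<bar>c\<^sub>2\<bar> \<le> C * M + M\<^sup>2 / 2 + n * e\<^sub>0 * exp (1 / n) + n * e\<^sub>1"
proof -
  define H where "H = C * M + M\<^sup>2 / 2"
  have source: "\<bar>\<theta> * (c\<^sub>1 * u x - (u x)\<^sup>2 / 2)\<bar> \<le> H" if "x \<in> {0..1}" for x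
    unfolding H_def using C M[OF that] \<theta> by (rule energy_source_bound)
  have exp_n: "exp (1 / n) - 1 \<ge> 1 / n" using exp_ge_add_one_self[of "1 / n"] by linarith
  have nonneg: "0 \<le> n * e\<^sub>0 * exp (1 / n)" "0 \<le> n * e\<^sub>1" using n data by auto
  have "c\<^sub>2 - H \<le> n * e\<^sub>0 * exp (1 / n)"
  proof (cases "c\<^sub>2 - H > 0")
    case True
    have "e 1 - (c\<^sub>2 - H) \<le> (e 0 - (c\<^sub>2 - H)) * exp (1 / n * (1 - 0))"
    proof (rule exponential_growth_upper[OF _ de])
      fix x :: real assume "x \<in> {0..1}"
      then show "(e x - c\<^sub>2 + \<theta> * (c\<^sub>1 * u x - (u x)\<^sup>2 / 2)) / n \<le> 1 / n * (e x - (c\<^sub>2 - H))"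
        using source[of x] n by (simp add: divide_right_mono abs_le_iff)
    qed auto
    then have "(c\<^sub>2 - H) * (exp (1 / n) - 1) \<le> e\<^sub>0 * exp (1 / n)" using bc data by (simp add: algebra_simps)
    moreover have "(c\<^sub>2 - H) * (1 / n) \<le> (c\<^sub>2 - H) * (exp (1 / n) - 1)"
      using True exp_n by (intro mult_left_mono) auto
    ultimately have "(c\<^sub>2 - H) / n \<le> e\<^sub>0 * exp (1 / n)" by simp
    then show ?thesis using n by (simp add: divide_le_eq mult_ac)
  qed (use nonneg in linarith)
  moreover have "- (c\<^sub>2 + H) \<le> n * e\<^sub>1"
  proof (cases "c\<^sub>2 + H < 0")
    case True
    have "e 1 - (c\<^sub>2 + H) \<ge> (e 0 - (c\<^sub>2 + H)) * exp (1 / n * (1 - 0))"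
    proof (rule exponential_growth[OF _ de])
      fix x :: real assume "x \<in> {0..1}"
      then show "1 / n * (e x - (c\<^sub>2 + H)) \<le> (e x - c\<^sub>2 + \<theta> * (c\<^sub>1 * u x - (u x)\<^sup>2 / 2)) / n"
        using source[of x] n by (simp add: divide_right_mono abs_le_iff)
    qed auto
    moreover have "0 < e\<^sub>0 * exp (1 / n)" using data by simp
    ultimately have "- (c\<^sub>2 + H) * (exp (1 / n) - 1) \<le> e\<^sub>1" using bc by (simp add: algebra_simps)
    moreover have "- (c\<^sub>2 + H) * (1 / n) \<le> - (c\<^sub>2 + H) * (exp (1 / n) - 1)"
      using True exp_n by (intro mult_left_mono) auto
    ultimately have "- (c\<^sub>2 + H) / n \<le> e\<^sub>1" by simp
    then show ?thesis using n by (simp add: divide_le_eq mult_ac)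
  qed (use nonneg in linarith)
  moreover have "H \<ge> 0" using source[of 0] by simp
  ultimately show ?thesis using nonneg unfolding H_def by linarith
qed

text \<open>If \<open>u\<close> reached \<open>\<delta>\<close>, the internal energy would be of order \<open>\<delta>\<close> there, which forces \<open>c\<^sub>2 > e\<^sub>0\<close>;
  from then on both \<open>u\<close> and \<open>e\<close> would be trapped at small values.\<close>

lemma u_ge_\<delta>:
  assumes "\<theta> = 1" "g > 0" "c\<^sub>1 \<le> R" "\<delta> < u\<^sub>0" "R * \<delta> / g < e\<^sub>1" "R * \<delta> / g + R * \<delta> < e\<^sub>0" "R \<ge> 0"
    and "t \<in> {0..1}"
  shows "u t \<ge> \<delta>"
proof -
  have "- u t \<le> - \<delta>"
  proof (rule stay_below[OF _ DERIV_minus[OF du] _ _ \<open>t \<in> {0..1}\<close>])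
    fix r :: real
    assume r: "0 \<le> r" "r \<le> 1" "- u r = - \<delta>"
      and "\<And>x. \<lbrakk>0 \<le> x; x \<le> r\<rbrakk> \<Longrightarrow> - u x \<le> - \<delta>"
    then have ge: "u x \<ge> \<delta>" if "0 \<le> x" "x \<le> r" for x using that by force
    have e_r: "e r > 0" using e_pos[OF \<open>\<theta> = 1\<close>] r by simp
    have "u r - c\<^sub>1 + g * (max 0 (e r) / max (u r) \<delta>) > 0"
    proof (rule ccontr)
      assume "\<not> ?thesis"
      then have p: "g * (e r / \<delta>) \<le> c\<^sub>1 - \<delta>" using r e_r by simp
      then have c1: "c\<^sub>1 \<ge> \<delta>" using e_r \<open>g > 0\<close> \<delta> by (smt (verit) divide_pos_pos mult_pos_pos)
      have "g * (e r / \<delta>) \<le> R" using p \<open>c\<^sub>1 \<le> R\<close> \<delta> by linarith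
      then have e_le: "e r \<le> R * \<delta> / g" using \<delta> \<open>g > 0\<close> by (simp add: field_simps)
      have u_le: "u x \<le> c\<^sub>1" if "0 \<le> x" "x \<le> r" for x
        using u_persist[of x r] that r c1 by force
      \<comment> \<open>Up to \<open>r\<close> the velocity lies between \<open>\<delta>\<close> and
        \<open>c\<^sub>1\<close>, so the source is nonnegative; with
        \<open>c\<^sub>2 \<le> e\<^sub>0\<close> the energy could not fall from
        \<open>e\<^sub>0\<close> to \<open>e r\<close>.\<close>
      have "e r - c\<^sub>2 \<ge> (e 0 - c\<^sub>2) * exp (1 / n * (r - 0))"
      proof (rule exponential_growth[OF _ de_sub])
        fix x assume x: "x \<in> {0..r}"
        have "0 \<le> u x" "u x \<le> c\<^sub>1" using ge[of x] u_le[of x] x \<delta> by auto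
        then have "0 \<le> c\<^sub>1 * u x - (u x)\<^sup>2 / 2"
          using mult_right_mono[of "u x" c\<^sub>1 "u x"] zero_le_power2[of "u x"]
          unfolding power2_eq_square by linarith
        then show "1 / n * (e x - c\<^sub>2) \<le> (e x - c\<^sub>2 + \<theta> * (c\<^sub>1 * u x - (u x)\<^sup>2 / 2)) / n"
          using n \<open>\<theta> = 1\<close> by (simp add: divide_right_mono)
      qed (use r in auto)
      moreover have "(e\<^sub>0 - c\<^sub>2) * 1 \<le> (e\<^sub>0 - c\<^sub>2) * exp (1 / n * (r - 0))" if "c\<^sub>2 \<le> e\<^sub>0"
        using that r n by (intro mult_left_mono) auto
      moreover have "0 \<le> R * \<delta>" using \<open>R \<ge> 0\<close> \<delta> by simp
      ultimately have c2: "c\<^sub>2 > e\<^sub>0"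
        using e_le assms(6) bc by (cases "c\<^sub>2 \<le> e\<^sub>0") auto
      \<comment> \<open>While \<open>e \<le> e r\<close>, the truncated denominator keeps the
        pressure at most \<open>c\<^sub>1 - \<delta>\<close>, so \<open>u\<close> stays below
        \<open>\<delta>\<close> and the source below \<open>R * \<delta>\<close>. Since
        \<open>c\<^sub>2 > e\<^sub>0\<close>, \<open>e\<close> then decreases and misses
        \<open>e\<^sub>1\<close>.\<close>
      have "e 1 \<le> e r"
      proof (rule stay_below[OF _ de_sub])
        fix q assume q: "r \<le> q" "q \<le> 1" "e q = e r" and le: "\<And>x. \<lbrakk>r \<le> x; x \<le> q\<rbrakk> \<Longrightarrow> e x \<le> e r"
        have "u q - \<delta> \<le> (u r - \<delta>) * exp (1 / a * (q - r))"
        proof (rule exponential_growth_upper[OF _ du_sub])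
          fix x assume x: "x \<in> {r..q}"
          have "g * (max 0 (e x) / max (u x) \<delta>) \<le> g * (e r / \<delta>)"
            using le[of x] x \<open>g > 0\<close> \<delta> e_r by (intro mult_left_mono frac_le) auto
          then show "(u x - c\<^sub>1 + g * (max 0 (e x) / max (u x) \<delta>)) / a \<le> 1 / a * (u x - \<delta>)"
            using p a by (simp add: divide_right_mono)
        qed (use q r in auto)
        then have "u q \<le> \<delta>" using r by simp
        then have "c\<^sub>1 * u q \<le> c\<^sub>1 * \<delta>" using c1 \<delta> by (intro mult_left_mono) auto
        also have "\<dots> \<le> R * \<delta>" using \<open>c\<^sub>1 \<le> R\<close> \<delta> by (intro mult_right_mono) auto
        finally have "c\<^sub>1 * u q - (u q)\<^sup>2 / 2 \<le> R * \<delta>"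
          by (smt (verit) zero_le_power2 divide_nonneg_nonneg)
        then show "(e q - c\<^sub>2 + \<theta> * (c\<^sub>1 * u q - (u q)\<^sup>2 / 2)) / n < 0"
          using e_le q assms(6) c2 n \<open>\<theta> = 1\<close> by (intro divide_neg_pos) auto
      qed (use r in auto)
      then show False using e_le assms(5) bc by simp
    qed
    then show "- ((u r - c\<^sub>1 + g * (max 0 (e r) / max (u r) \<delta>)) / a) < 0" using a by simp
  qed (use bc \<open>\<delta> < u\<^sub>0\<close> in auto)
  then show ?thesis by simp
qed

text \<open>The disjunction describes the two phases of the deformation, each with its own upper
  bound.\<close>

lemma c1_abs:
  assumes "\<theta> = 1 \<or> g = 0" "g \<le> G" "\<delta> \<le> u\<^sub>1 / 2"
  shows "\<bar>c\<^sub>1\<bar> \<le> a * u\<^sub>1 + a * u\<^sub>0 * exp (1 / a) + \<bar>c1_bound a n G u\<^sub>0 e\<^sub>0 u\<^sub>1 e\<^sub>1\<bar>"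
proof -
  have "0 \<le> a * u\<^sub>1" "0 \<le> a * u\<^sub>0 * exp (1 / a)" using a data by auto
  then show ?thesis using assms(1) c1_lower c1_no_pressure c1_upper[OF _ assms(2,3)] by fastforce
qed

end

section \<open>Solution of the normalized system\<close>

lemma truncated_quotient_lipschitz:
  fixes \<delta> N :: real
  assumes "\<delta> > 0" "N \<ge> 0"
  shows "\<bar>max 0 (min N e) / max u \<delta> - max 0 (min N e') / max u' \<delta>\<bar>
    \<le> \<bar>e - e'\<bar> / \<delta> + N / \<delta>\<^sup>2 * \<bar>u - u'\<bar>"
proof -
  define x x' y y' where "x = max 0 (min N e)" "x' = max 0 (min N e')" "y = max u \<delta>" "y' = max u' \<delta>"
  note defs = this
  have x: "\<bar>x - x'\<bar> \<le> \<bar>e - e'\<bar>" "\<bar>x'\<bar> \<le> N" and y: "\<bar>y' - y\<bar> \<le> \<bar>u - u'\<bar>" "\<delta> \<le> y" "\<delta> \<le> y'"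
    using assms by (auto simp: defs)
  have "x / y - x' / y' = (x - x') / y + x' * (y' - y) / (y * y')"
    using assms y by (simp add: field_simps)
  also have "\<bar>\<dots>\<bar> \<le> \<bar>x - x'\<bar> / y + \<bar>x'\<bar> * \<bar>y' - y\<bar> / (y * y')"
    using assms y by (intro abs_triangle_ineq[THEN order_trans]) (simp add: abs_mult)
  also have "\<dots> \<le> \<bar>e - e'\<bar> / \<delta> + N * \<bar>u - u'\<bar> / (\<delta> * \<delta>)"
    using assms x y by (intro add_mono frac_le mult_mono) auto
  finally show ?thesis by (simp add: defs power2_eq_square)
qed

lemma truncated_source_lipschitz:
  fixes c M b \<theta> :: real
  assumes "\<bar>c\<bar> \<le> b" "M \<ge> 0" "0 \<le> \<theta>" "\<theta> \<le> 1"
  defines "w \<equiv> \<lambda>u. max (- M) (min M u)"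
  shows "\<bar>\<theta> * (c * w u - (w u)\<^sup>2 / 2) - \<theta> * (c * w u' - (w u')\<^sup>2 / 2)\<bar> \<le> (b + M) * \<bar>u - u'\<bar>"
proof -
  have w: "\<bar>w u - w u'\<bar> \<le> \<bar>u - u'\<bar>" "\<bar>w u\<bar> \<le> M" "\<bar>w u'\<bar> \<le> M"
    using assms(2) by (auto simp: w_def)
  have "\<bar>c - (w u + w u') / 2\<bar> * \<bar>w u - w u'\<bar> \<le> (b + M) * \<bar>u - u'\<bar>"
  proof (rule mult_mono)
    have "\<bar>(w u + w u') / 2\<bar> \<le> M" using w(2,3) by (simp add: abs_le_iff field_simps)
    then show "\<bar>c - (w u + w u') / 2\<bar> \<le> b + M"
      using assms(1) by (intro abs_triangle_ineq4[THEN order_trans] add_mono)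
  qed (use w assms(1,2) in auto)
  from mult_mono[OF _ this, of "\<bar>\<theta>\<bar>" 1]
  have "\<bar>\<theta>\<bar> * (\<bar>c - (w u + w u') / 2\<bar> * \<bar>w u - w u'\<bar>) \<le> 1 * ((b + M) * \<bar>u - u'\<bar>)"
    using assms(3,4) by simp
  moreover have "\<theta> * (c * w u - (w u)\<^sup>2 / 2) - \<theta> * (c * w u' - (w u')\<^sup>2 / 2)
      = \<theta> * ((c - (w u + w u') / 2) * (w u - w u'))"
    by (simp add: power2_eq_square field_simps)
  ultimately show ?thesis by (simp add: abs_mult)
qed

text \<open>The homotopy \<open>l\<close> first switches on the source of the energy equation and then the pressure, so
  that \<open>l = 0\<close> is linear and \<open>l = 1\<close> is the full system.\<close>

definition pressure_factor :: "real \<Rightarrow> real \<Rightarrow> real" where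
  "pressure_factor G l = G * max 0 (2 * l - 1)"

definition source_factor :: "real \<Rightarrow> real" where
  "source_factor l = min 1 (2 * l)"

text \<open>The linear terms are left untouched: only the quotient and the quadratic source obstruct
  a global Lipschitz bound.\<close>

definition truncated_field ::
    "real \<Rightarrow> real \<Rightarrow> real \<Rightarrow> real \<Rightarrow> real \<Rightarrow> real \<Rightarrow> real \<times> real \<times> real \<Rightarrow> real \<times> real \<Rightarrow> real \<times> real" where
  "truncated_field a n G \<delta> M N = (\<lambda>(l, c\<^sub>1, c\<^sub>2) (u, e).
     ((u - c\<^sub>1 + pressure_factor G l * (max 0 (min N e) / max u \<delta>)) / a,
      (e - c\<^sub>2 + source_factor l * (c\<^sub>1 * max (- M) (min M u) - (max (- M) (min M u))\<^sup>2 / 2)) / n))"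

lemma truncated_field_lipschitz:
  assumes pos: "a > 0" "n > 0" "G \<ge> 0" "\<delta> > 0" "M \<ge> 0" "N \<ge> 0"
    and l: "0 \<le> l" "l \<le> 1" and c: "\<bar>c\<^sub>1\<bar> \<le> b"
  shows "norm (truncated_field a n G \<delta> M N (l, c\<^sub>1, c\<^sub>2) x - truncated_field a n G \<delta> M N (l, c\<^sub>1, c\<^sub>2) y)
    \<le> ((1 + G * (1 / \<delta> + N / \<delta>\<^sup>2)) / a + (1 + (b + M)) / n) * norm (x - y)"
proof -
  obtain u e u' e' where xy: "x = (u, e)" "y = (u', e')" by fastforce
  define D where "D = norm (x - y)"
  have D: "\<bar>u - u'\<bar> \<le> D" "\<bar>e - e'\<bar> \<le> D"
    using norm_fst_le[of "u - u'" "e - e'"] norm_snd_le[of "e - e'" "u - u'"] by (auto simp: D_def xy)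
  have "D \<ge> 0" by (simp add: D_def)
  define q where "q u e = max 0 (min N e) / max u \<delta>" for u e
  define s where "s u = source_factor l * (c\<^sub>1 * max (- M) (min M u) - (max (- M) (min M u))\<^sup>2 / 2)" for u
  have "\<bar>q u e - q u' e'\<bar> \<le> \<bar>e - e'\<bar> / \<delta> + N / \<delta>\<^sup>2 * \<bar>u - u'\<bar>"
    unfolding q_def using pos(4,6) by (rule truncated_quotient_lipschitz)
  also have "\<dots> \<le> D / \<delta> + N / \<delta>\<^sup>2 * D"
    using D pos by (intro add_mono divide_right_mono mult_left_mono) auto
  finally have "\<bar>q u e - q u' e'\<bar> \<le> (1 / \<delta> + N / \<delta>\<^sup>2) * D" by (simp add: algebra_simps)
  moreover have "\<bar>pressure_factor G l\<bar> \<le> G"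
    using pos l by (auto simp: pressure_factor_def abs_mult mult_left_le)
  ultimately have "\<bar>pressure_factor G l\<bar> * \<bar>q u e - q u' e'\<bar> \<le> G * ((1 / \<delta> + N / \<delta>\<^sup>2) * D)"
    using pos by (intro mult_mono) auto
  then have "\<bar>(u - u') + pressure_factor G l * (q u e - q u' e')\<bar> \<le> D + G * ((1 / \<delta> + N / \<delta>\<^sup>2) * D)"
    using D(1) by (intro abs_triangle_ineq[THEN order_trans] add_mono) (auto simp: abs_mult)
  then have "\<bar>(u - u') + pressure_factor G l * (q u e - q u' e')\<bar> / a
      \<le> (D + G * ((1 / \<delta> + N / \<delta>\<^sup>2) * D)) / a"
    using pos by (intro divide_right_mono) auto
  moreover have "fst (truncated_field a n G \<delta> M N (l, c\<^sub>1, c\<^sub>2) x - truncated_field a n G \<delta> M N (l, c\<^sub>1, c\<^sub>2) y)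
      = ((u - u') + pressure_factor G l * (q u e - q u' e')) / a"
    by (simp add: truncated_field_def xy q_def diff_divide_distrib add_divide_distrib right_diff_distrib)
  ultimately have first:
    "\<bar>fst (truncated_field a n G \<delta> M N (l, c\<^sub>1, c\<^sub>2) x - truncated_field a n G \<delta> M N (l, c\<^sub>1, c\<^sub>2) y)\<bar>
      \<le> (D + G * ((1 / \<delta> + N / \<delta>\<^sup>2) * D)) / a"
    using pos by (simp only: abs_divide abs_of_pos)
  have "\<bar>s u - s u'\<bar> \<le> (b + M) * \<bar>u - u'\<bar>"
    unfolding s_def using c pos l by (intro truncated_source_lipschitz) (auto simp: source_factor_def)
  also have "\<dots> \<le> (b + M) * D" using D c pos by (intro mult_left_mono) auto
  finally have "\<bar>(e - e') + (s u - s u')\<bar> / n \<le> (D + (b + M) * D) / n"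
    using D(2) pos by (intro divide_right_mono abs_triangle_ineq[THEN order_trans] add_mono) auto
  moreover have "snd (truncated_field a n G \<delta> M N (l, c\<^sub>1, c\<^sub>2) x - truncated_field a n G \<delta> M N (l, c\<^sub>1, c\<^sub>2) y)
      = ((e - e') + (s u - s u')) / n"
    by (simp add: truncated_field_def xy s_def diff_divide_distrib add_divide_distrib)
  ultimately have second:
    "\<bar>snd (truncated_field a n G \<delta> M N (l, c\<^sub>1, c\<^sub>2) x - truncated_field a n G \<delta> M N (l, c\<^sub>1, c\<^sub>2) y)\<bar>
      \<le> (D + (b + M) * D) / n"
    using pos by (simp only: abs_divide abs_of_pos)
  have "norm (truncated_field a n G \<delta> M N (l, c\<^sub>1, c\<^sub>2) x - truncated_field a n G \<delta> M N (l, c\<^sub>1, c\<^sub>2) y)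
      \<le> (D + G * ((1 / \<delta> + N / \<delta>\<^sup>2) * D)) / a + (D + (b + M) * D) / n"
    using first second
      norm_Pair_le[of "fst (truncated_field a n G \<delta> M N (l, c\<^sub>1, c\<^sub>2) x - truncated_field a n G \<delta> M N (l, c\<^sub>1, c\<^sub>2) y)"
        "snd (truncated_field a n G \<delta> M N (l, c\<^sub>1, c\<^sub>2) x - truncated_field a n G \<delta> M N (l, c\<^sub>1, c\<^sub>2) y)"]
    unfolding real_norm_def prod.collapse by linarith
  also have "\<dots> = ((1 + G * (1 / \<delta> + N / \<delta>\<^sup>2)) / a + (1 + (b + M)) / n) * D"
    by (simp add: add_divide_distrib distrib_right distrib_left mult.assoc)
  finally show ?thesis by (simp only: D_def)
qed

lemma truncated_field_continuous:
  assumes "a \<noteq> 0" "n \<noteq> 0" "\<delta> > 0"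
  shows "continuous_on S (\<lambda>(p, x). truncated_field a n G \<delta> M N p x)"
proof -
  have "max u \<delta> \<noteq> 0" for u using assms by auto
  then show ?thesis
    unfolding truncated_field_def pressure_factor_def source_factor_def split_beta
    using assms by (auto intro!: continuous_intros)
qed

lemma normalized_system_solvable:
  fixes a n G u\<^sub>0 e\<^sub>0 u\<^sub>1 e\<^sub>1 :: real
  assumes a: "a > 0" and n: "n > 0" and G: "G > 0"
    and data: "u\<^sub>0 > 0" "e\<^sub>0 > 0" "u\<^sub>1 > 0" "e\<^sub>1 > 0"
  obtains c\<^sub>1 c\<^sub>2 u e where
    "\<And>t. t \<in> {0..1} \<Longrightarrow> (u has_real_derivative (u t - c\<^sub>1 + G * (e t / u t)) / a) (at t within {0..1})"
    "\<And>t. t \<in> {0..1} \<Longrightarrow>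
      (e has_real_derivative (e t - c\<^sub>2 + (c\<^sub>1 * u t - (u t)\<^sup>2 / 2)) / n) (at t within {0..1})"
    "\<And>t. t \<in> {0..1} \<Longrightarrow> u t > 0" "\<And>t. t \<in> {0..1} \<Longrightarrow> e t > 0"
    "u 0 = u\<^sub>0" "e 0 = e\<^sub>0" "u 1 = u\<^sub>1" "e 1 = e\<^sub>1"
proof -
  \<comment> \<open>\<open>C\<^sub>1\<close> and \<open>C\<^sub>2\<close> depend only on the data;
    \<open>M\<close> and \<open>N\<close> are derived from the radius \<open>b\<close>, and
    \<open>\<delta>\<close> from \<open>C\<^sub>1\<close>, so the choices are not circular.\<close>
  define U where "U C = C + u\<^sub>1 + (u\<^sub>0 + C) * exp (1 / a)" for C
  have U: "U C \<ge> 0" if "C \<ge> 0" for C using that data by (simp add: U_def)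
  define C\<^sub>1 where "C\<^sub>1 = a * u\<^sub>1 + a * u\<^sub>0 * exp (1 / a) + \<bar>c1_bound a n G u\<^sub>0 e\<^sub>0 u\<^sub>1 e\<^sub>1\<bar>"
  define C\<^sub>2 where "C\<^sub>2 = C\<^sub>1 * U C\<^sub>1 + (U C\<^sub>1)\<^sup>2 / 2 + n * e\<^sub>0 * exp (1 / n) + n * e\<^sub>1"
  have C: "C\<^sub>1 \<ge> 0" "C\<^sub>2 \<ge> 0" using a n data U by (auto simp: C\<^sub>1_def C\<^sub>2_def)
  define K\<^sub>1 K\<^sub>2 where "K\<^sub>1 = exp (1 / a) - 1" and "K\<^sub>2 = exp (1 / n) - 1"
  have K: "K\<^sub>1 > 0" "K\<^sub>2 > 0" using a n by (auto simp: K\<^sub>1_def K\<^sub>2_def)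
  define q where "q = ((u\<^sub>0 * exp (1 / a) - u\<^sub>1) / K\<^sub>1, (e\<^sub>0 * exp (1 / n) - e\<^sub>1) / K\<^sub>2)"
  define B where "B = C\<^sub>1 + C\<^sub>2 + norm q"
  define b where "b = B + 1"
  have "B \<ge> 0" "b \<ge> 0" using C by (auto simp: B_def b_def)
  define M where "M = U b"
  define H where "H = b * M + M\<^sup>2 / 2"
  define N where "N = (e\<^sub>0 + (b + H)) * exp (1 / n)"
  have "M \<ge> 0" using U \<open>b \<ge> 0\<close> by (simp add: M_def)
  then have "H \<ge> 0" using \<open>b \<ge> 0\<close> by (simp add: H_def)
  then have "N \<ge> 0" using \<open>b \<ge> 0\<close> data by (simp add: N_def)
  \<comment> \<open>Chosen so that \<open>\<delta> * k \<le> e\<^sub>0\<close> and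
    \<open>\<delta> * k \<le> e\<^sub>1\<close> yield the smallness conditions of
    \<open>u_ge_\<delta>\<close>.\<close>
  define k where "k = 2 * (C\<^sub>1 / G + C\<^sub>1 + 1)"
  define \<delta> where "\<delta> = Min {u\<^sub>0 / 2, u\<^sub>1 / 2, e\<^sub>0 / k, e\<^sub>1 / k}"
  have "k > 0" using C G by (simp add: k_def add_nonneg_pos)
  then have "\<delta> > 0" using data by (simp add: \<delta>_def)
  have \<delta>_small: "\<delta> < u\<^sub>0" "\<delta> \<le> u\<^sub>1 / 2" "C\<^sub>1 * \<delta> / G < e\<^sub>1" "C\<^sub>1 * \<delta> / G + C\<^sub>1 * \<delta> < e\<^sub>0"
  proof -
    have le: "\<delta> \<le> u\<^sub>0 / 2" "\<delta> \<le> u\<^sub>1 / 2" "\<delta> \<le> e\<^sub>0 / k" "\<delta> \<le> e\<^sub>1 / k"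
      unfolding \<delta>_def by (rule Min_le; simp)+
    then have "\<delta> * k \<le> e\<^sub>0" "\<delta> * k \<le> e\<^sub>1" using \<open>k > 0\<close> by (simp_all add: le_divide_eq)
    moreover have "\<delta> * k = 2 * (C\<^sub>1 * \<delta> / G) + 2 * (C\<^sub>1 * \<delta>) + 2 * \<delta>"
      by (simp add: k_def algebra_simps)
    moreover have "0 \<le> C\<^sub>1 * \<delta> / G" "0 \<le> C\<^sub>1 * \<delta>" using C G \<open>\<delta> > 0\<close> by auto
    ultimately show "C\<^sub>1 * \<delta> / G < e\<^sub>1" "C\<^sub>1 * \<delta> / G + C\<^sub>1 * \<delta> < e\<^sub>0"
      using \<open>\<delta> > 0\<close> by linarith+
    show "\<delta> < u\<^sub>0" "\<delta> \<le> u\<^sub>1 / 2" using le data by linarith+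
  qed
  define P where "P = {0..1::real} \<times> cball (0 :: real \<times> real) b"
  define F where "F = truncated_field a n G \<delta> M N"
  have c_abs: "\<bar>c\<^sub>1\<bar> \<le> b" "\<bar>c\<^sub>2\<bar> \<le> b" if "norm (c\<^sub>1, c\<^sub>2) \<le> b" for c\<^sub>1 c\<^sub>2 :: real
    using that norm_fst_le[of c\<^sub>1 c\<^sub>2] norm_snd_le[of c\<^sub>2 c\<^sub>1] by auto
  have lip: "norm (F p x - F p y) \<le> ((1 + G * (1 / \<delta> + N / \<delta>\<^sup>2)) / a + (1 + (b + M)) / n) * norm (x - y)"
    if "p \<in> P" for p x y
    using that c_abs G a n \<open>\<delta> > 0\<close> \<open>M \<ge> 0\<close> \<open>N \<ge> 0\<close>
    by (cases p) (auto simp: P_def F_def intro!: truncated_field_lipschitz)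
  have F_cont: "continuous_on (P \<times> UNIV) (\<lambda>(p, x). F p x)"
    unfolding F_def using a n \<open>\<delta> > 0\<close> by (intro truncated_field_continuous) auto
  have P: "compact P" "convex P" "P \<noteq> {}"
    using \<open>b \<ge> 0\<close> by (auto simp: P_def intro: compact_Times convex_Times)
  obtain X where X_cont: "continuous_on (P \<times> {0..1}) (\<lambda>(p, t). X p t)"
    and X_0: "\<And>p. p \<in> P \<Longrightarrow> X p 0 = (u\<^sub>0, e\<^sub>0)"
    and X_deriv: "\<And>p t. \<lbrakk>p \<in> P; t \<in> {0..1}\<rbrakk> \<Longrightarrow>
           (X p has_vector_derivative F p (X p t)) (at t within {0..1})"
    using ode_parameter_solution[OF P F_cont lip] by blast
  have du: "((\<lambda>t. fst (X p t)) has_real_derivative fst (F p (X p t))) (at t within {0..1})"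
    and de: "((\<lambda>t. snd (X p t)) has_real_derivative snd (F p (X p t))) (at t within {0..1})"
    if "p \<in> P" "t \<in> {0..1}" for p t
    unfolding has_real_derivative_iff_has_vector_derivative
    using bounded_linear.has_vector_derivative[OF bounded_linear_fst X_deriv[OF that]]
      bounded_linear.has_vector_derivative[OF bounded_linear_snd X_deriv[OF that]] by auto
  have mem_P: "(l, c) \<in> P" if "0 \<le> l" "l \<le> 1" "norm c \<le> b" for l c
    using that by (simp add: P_def)
  have bvp: "regularized_bvp a n (pressure_factor G l) (source_factor l) \<delta> c\<^sub>1 c\<^sub>2 u\<^sub>0 e\<^sub>0 u\<^sub>1 e\<^sub>1
      (\<lambda>t. fst (X (l, c\<^sub>1, c\<^sub>2) t)) (\<lambda>t. snd (X (l, c\<^sub>1, c\<^sub>2) t))"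
    if l: "0 \<le> l" "l \<le> 1" and c: "norm (c\<^sub>1, c\<^sub>2) \<le> b" and X1: "X (l, c\<^sub>1, c\<^sub>2) 1 = (u\<^sub>1, e\<^sub>1)" for l c\<^sub>1 c\<^sub>2
  proof -
    define p where "p = (l, c\<^sub>1, c\<^sub>2)"
    have p: "p \<in> P" using l c mem_P by (simp add: p_def)
    define u e where "u t = fst (X p t)" and "e t = snd (X p t)" for t
    have l_factors: "pressure_factor G l \<ge> 0" "0 \<le> source_factor l" "source_factor l \<le> 1"
      using l G by (auto simp: pressure_factor_def source_factor_def)
    have bc: "u 0 = u\<^sub>0" "e 0 = e\<^sub>0" "u 1 = u\<^sub>1" "e 1 = e\<^sub>1"
      using X_0[OF p] X1 by (auto simp: u_def e_def p_def)
    have du': "(u has_real_derivative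
        (u t - c\<^sub>1 + pressure_factor G l * (max 0 (min N (e t)) / max (u t) \<delta>)) / a) (at t within {0..1})"
      if "t \<in> {0..1}" for t
      using du[OF p that] by (simp add: u_def[abs_def] e_def F_def p_def truncated_field_def split_beta)
    \<comment> \<open>The bound on \<open>u\<close> comes first, from the sign of the pressure
      alone. It deactivates the cut-off \<open>M\<close>, and the resulting source bound deactivates
      \<open>N\<close>.\<close>
    interpret velocity a c\<^sub>1 u\<^sub>0 u\<^sub>1 "\<lambda>t. pressure_factor G l * (max 0 (min N (e t)) / max (u t) \<delta>)" u
      by unfold_locales
        (use a data bc du' l_factors \<open>\<delta> > 0\<close> in \<open>auto intro!: mult_nonneg_nonneg divide_nonneg_nonneg\<close>)
    have u_M: "\<bar>u t\<bar> \<le> M" if "t \<in> {0..1}" for t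
      using u_abs[OF that c_abs(1)[OF c]] by (simp add: M_def U_def)
    have de': "(e has_real_derivative
        (e t - c\<^sub>2 + source_factor l * (c\<^sub>1 * u t - (u t)\<^sup>2 / 2)) / n) (at t within {0..1})"
      if "t \<in> {0..1}" for t
    proof -
      have "max (- M) (min M (u t)) = u t" using u_M[OF that] by auto
      then show ?thesis
        using de[OF p that] by (simp add: u_def e_def[abs_def] F_def p_def truncated_field_def split_beta)
    qed
    have e_N: "e t \<le> N" if t: "t \<in> {0..1}" for t
    proof -
      have "e t - (- (b + H)) \<le> (e 0 - (- (b + H))) * exp (1 / n * (t - 0))"
      proof (rule exponential_growth_upper)
        fix x assume x: "x \<in> {0..t}"
        show "(e has_real_derivative (e x - c\<^sub>2 + source_factor l * (c\<^sub>1 * u x - (u x)\<^sup>2 / 2)) / n)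
            (at x within {0..t})"
          by (rule DERIV_subset[OF de']) (use x t in auto)
        have "\<bar>source_factor l * (c\<^sub>1 * u x - (u x)\<^sup>2 / 2)\<bar> \<le> H"
          unfolding H_def using c_abs[OF c] u_M[of x] x t l_factors
          by (intro energy_source_bound) auto
        then have "e x - c\<^sub>2 + source_factor l * (c\<^sub>1 * u x - (u x)\<^sup>2 / 2) \<le> e x - (- (b + H))"
          using c_abs[OF c] by linarith
        then show "(e x - c\<^sub>2 + source_factor l * (c\<^sub>1 * u x - (u x)\<^sup>2 / 2)) / n \<le> 1 / n * (e x - (- (b + H)))"
          using n by (simp add: divide_right_mono)
      qed (use t in simp)
      also have "\<dots> \<le> N"
      proof -
        have "exp (1 / n * (t - 0)) \<le> exp (1 / n)" using t n by (simp add: divide_right_mono)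
        then have "(e\<^sub>0 + (b + H)) * exp (1 / n * (t - 0)) \<le> N"
          unfolding N_def using data \<open>b \<ge> 0\<close> \<open>H \<ge> 0\<close> by (intro mult_left_mono) auto
        then show ?thesis by (simp only: bc diff_minus_eq_add)
      qed
      finally show ?thesis using \<open>b \<ge> 0\<close> \<open>H \<ge> 0\<close> by linarith
    qed
    have "regularized_bvp a n (pressure_factor G l) (source_factor l) \<delta> c\<^sub>1 c\<^sub>2 u\<^sub>0 e\<^sub>0 u\<^sub>1 e\<^sub>1 u e"
    proof (rule regularized_bvp.intro)
      fix t :: real assume t: "t \<in> {0..1}"
      show "(u has_real_derivative (u t - c\<^sub>1 + pressure_factor G l * (max 0 (e t) / max (u t) \<delta>)) / a)
          (at t within {0..1})"
        using du'[OF t] unfolding min_absorb2[OF e_N[OF t]] .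
    qed (rule a n \<open>\<delta> > 0\<close> l_factors data bc de' | assumption)+
    then show ?thesis unfolding u_def[abs_def] e_def[abs_def] p_def .
  qed
  have c_bound: "\<bar>c\<^sub>1\<bar> \<le> C\<^sub>1" "\<bar>c\<^sub>2\<bar> \<le> C\<^sub>2"
    if l: "0 \<le> l" "l \<le> 1" and c: "norm (c\<^sub>1, c\<^sub>2) \<le> b" and X1: "X (l, c\<^sub>1, c\<^sub>2) 1 = (u\<^sub>1, e\<^sub>1)" for l c\<^sub>1 c\<^sub>2
  proof -
    interpret regularized_bvp a n "pressure_factor G l" "source_factor l" \<delta> c\<^sub>1 c\<^sub>2 u\<^sub>0 e\<^sub>0 u\<^sub>1 e\<^sub>1
        "\<lambda>t. fst (X (l, c\<^sub>1, c\<^sub>2) t)" "\<lambda>t. snd (X (l, c\<^sub>1, c\<^sub>2) t)"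
      by (rule bvp) fact+
    \<comment> \<open>The source is complete from \<open>l = 1/2\<close> on, and the pressure
      vanishes up to there.\<close>
    have "source_factor l = 1 \<or> pressure_factor G l = 0"
      by (auto simp: source_factor_def pressure_factor_def)
    moreover have "pressure_factor G l \<le> G"
      using G l by (auto simp: pressure_factor_def mult_left_le)
    ultimately show C1: "\<bar>c\<^sub>1\<bar> \<le> C\<^sub>1"
      unfolding C\<^sub>1_def using \<delta>_small(2) by (rule c1_abs)
    show "\<bar>c\<^sub>2\<bar> \<le> C\<^sub>2"
      unfolding C\<^sub>2_def by (rule c2_abs) (use u_abs[OF _ C1] C1 in \<open>auto simp: U_def\<close>)
  qed
  \<comment> \<open>The scalings by \<open>K\<^sub>1\<close> and \<open>K\<^sub>2\<close> invert the
    linear dependence of the end values on \<open>c\<close> at \<open>l = 0\<close>, so that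
    \<open>\<Phi> 0\<close> is the constant \<open>q\<close>.\<close>
  define \<Phi> where "\<Phi> l c = c + ((fst (X (l, c) 1) - u\<^sub>1) / K\<^sub>1, (snd (X (l, c) 1) - e\<^sub>1) / K\<^sub>2)" for l c
  have fixed: "X (l, c) 1 = (u\<^sub>1, e\<^sub>1)" if "\<Phi> l c = c" for l c
    using that K by (cases c, cases "X (l, c) 1") (auto simp: \<Phi>_def)
  obtain c where c: "norm c \<le> B" "\<Phi> 1 c = c"
  proof (rule homotopy_fixed_point)
    have "continuous_on P (\<lambda>p. X p 1)"
    proof -
      have "continuous_on P (\<lambda>p. (p, 1::real))" by (intro continuous_intros)
      moreover have "(\<lambda>p. (p, 1)) ` P \<subseteq> P \<times> {0..1::real}" by auto
      ultimately show ?thesis using continuous_on_compose2[OF X_cont, of P "\<lambda>p. (p, 1)"] by simp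
    qed
    then have "continuous_on P (\<lambda>p. snd p + ((fst (X p 1) - u\<^sub>1) / K\<^sub>1, (snd (X p 1) - e\<^sub>1) / K\<^sub>2))"
      using K by (intro continuous_intros) auto
    then show "continuous_on ({0..1} \<times> cball 0 (B + 1)) (\<lambda>(l, c). \<Phi> l c)"
      by (simp add: \<Phi>_def P_def b_def split_beta)
    show "norm q \<le> B" using C by (simp add: B_def)
    show "norm c \<le> B" if "0 \<le> l" "l \<le> 1" "norm c \<le> B + 1" "\<Phi> l c = c" for l c
    proof -
      obtain c\<^sub>1 c\<^sub>2 where c: "c = (c\<^sub>1, c\<^sub>2)" by fastforce
      have "norm c \<le> \<bar>c\<^sub>1\<bar> + \<bar>c\<^sub>2\<bar>" using norm_Pair_le[of c\<^sub>1 c\<^sub>2] by (simp add: c)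
      moreover have "\<bar>c\<^sub>1\<bar> \<le> C\<^sub>1" "\<bar>c\<^sub>2\<bar> \<le> C\<^sub>2"
        using c_bound[of l c\<^sub>1 c\<^sub>2] fixed[OF that(4)] that by (simp_all add: c b_def)
      ultimately show ?thesis by (simp add: B_def add_increasing2)
    qed
    show "\<Phi> 0 c = q" if "norm c \<le> B + 1" for c
    proof -
      obtain c\<^sub>1 c\<^sub>2 where c: "c = (c\<^sub>1, c\<^sub>2)" by fastforce
      have p: "(0, c\<^sub>1, c\<^sub>2) \<in> P" using that mem_P[of 0 c] by (simp add: c b_def)
      have F0: "fst (F (0, c\<^sub>1, c\<^sub>2) x) = 1 / a * (fst x - c\<^sub>1)" "snd (F (0, c\<^sub>1, c\<^sub>2) x) = 1 / n * (snd x - c\<^sub>2)" for x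
        by (simp_all add: F_def truncated_field_def pressure_factor_def source_factor_def split_beta)
      \<comment> \<open>Both comparison inequalities are equalities for the linear system, which
        gives its solution at 1 explicitly.\<close>
      have "fst (X (0, c\<^sub>1, c\<^sub>2) 1) - c\<^sub>1 = (fst (X (0, c\<^sub>1, c\<^sub>2) 0) - c\<^sub>1) * exp (1 / a * (1 - 0))"
        using exponential_growth[where s = 0 and t = 1 and r = "1 / a" and K = c\<^sub>1, OF _ du[OF p]]
          exponential_growth_upper[where s = 0 and t = 1 and r = "1 / a" and K = c\<^sub>1, OF _ du[OF p]]
        by (intro antisym) (simp_all add: F0)
      moreover have "snd (X (0, c\<^sub>1, c\<^sub>2) 1) - c\<^sub>2 = (snd (X (0, c\<^sub>1, c\<^sub>2) 0) - c\<^sub>2) * exp (1 / n * (1 - 0))"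
        using exponential_growth[where s = 0 and t = 1 and r = "1 / n" and K = c\<^sub>2, OF _ de[OF p]]
          exponential_growth_upper[where s = 0 and t = 1 and r = "1 / n" and K = c\<^sub>2, OF _ de[OF p]]
        by (intro antisym) (simp_all add: F0)
      ultimately have "fst (X (0, c\<^sub>1, c\<^sub>2) 1) = u\<^sub>0 * exp (1 / a) - c\<^sub>1 * K\<^sub>1"
          "snd (X (0, c\<^sub>1, c\<^sub>2) 1) = e\<^sub>0 * exp (1 / n) - c\<^sub>2 * K\<^sub>2"
        by (simp_all add: X_0[OF p] K\<^sub>1_def K\<^sub>2_def algebra_simps)
      then show ?thesis using K by (simp add: \<Phi>_def q_def c diff_divide_distrib)
    qed
  qed
  obtain c\<^sub>1 c\<^sub>2 where c12: "c = (c\<^sub>1, c\<^sub>2)" by fastforce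
  define u e where "u t = fst (X (1, c\<^sub>1, c\<^sub>2) t)" and "e t = snd (X (1, c\<^sub>1, c\<^sub>2) t)" for t
  have c_le: "norm (c\<^sub>1, c\<^sub>2) \<le> b" and X1: "X (1, c\<^sub>1, c\<^sub>2) 1 = (u\<^sub>1, e\<^sub>1)"
    using c fixed[OF c(2)] by (simp_all add: c12 b_def)
  have "regularized_bvp a n G 1 \<delta> c\<^sub>1 c\<^sub>2 u\<^sub>0 e\<^sub>0 u\<^sub>1 e\<^sub>1 u e"
    using bvp[OF _ _ c_le X1] by (simp add: pressure_factor_def source_factor_def u_def[abs_def] e_def[abs_def])
  then interpret regularized_bvp a n G 1 \<delta> c\<^sub>1 c\<^sub>2 u\<^sub>0 e\<^sub>0 u\<^sub>1 e\<^sub>1 u e .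
  have "\<bar>c\<^sub>1\<bar> \<le> C\<^sub>1" using c_bound(1)[OF _ _ c_le X1] by simp
  then have u_ge: "u t \<ge> \<delta>" if "t \<in> {0..1}" for t
    using u_ge_\<delta>[OF _ G _ \<delta>_small(1,3,4) C(1) that] by simp
  have e_gt: "e t > 0" if "t \<in> {0..1}" for t using e_pos that by simp
  show thesis
  proof (rule that)
    fix t :: real assume t: "t \<in> {0..1}"
    have "max 0 (e t) / max (u t) \<delta> = e t / u t" using u_ge[OF t] e_gt[OF t] by (simp add: max_def)
    then show "(u has_real_derivative (u t - c\<^sub>1 + G * (e t / u t)) / a) (at t within {0..1})"
      using deriv_u[OF t] by simp
    show "(e has_real_derivative (e t - c\<^sub>2 + (c\<^sub>1 * u t - (u t)\<^sup>2 / 2)) / n) (at t within {0..1})"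
      using regularized_bvp_axioms t unfolding regularized_bvp_def by simp
    show "u t > 0" using u_ge[OF t] \<open>\<delta> > 0\<close> by linarith
    show "e t > 0" by (rule e_gt[OF t])
  qed (use bc in auto)
qed

section \<open>The steady Navier-Stokes equations\<close>

lemma has_real_derivative_cong_on:
  fixes f g :: "real \<Rightarrow> real"
  assumes "x \<in> S" "\<And>y. y \<in> S \<Longrightarrow> f y = g y"
    and "(g has_real_derivative d) (at x within S)"
  shows "(f has_real_derivative d) (at x within S)"
  using assms unfolding has_field_derivative_def by (rule has_derivative_transform)

text \<open>The fluxes equal their first integrals only on \<open>{0..1}\<close>, since
  \<open>u\<close> may vanish elsewhere.\<close>

lemma dx_eqI:
  assumes "x \<in> {0..1}" "\<And>y. y \<in> {0..1} \<Longrightarrow> f y = g y"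
    and "(g has_real_derivative d) (at x within {0..1})"
  shows "dx f x = d"
  by (rule dx_unique[OF assms(1) has_real_derivative_cong_on[OF assms]])

lemma Ck_unit_cong:
  assumes "Ck_unit k g" "\<And>x. x \<in> {0..1} \<Longrightarrow> f x = g x"
  shows "Ck_unit k f"
  using assms
proof (induction k arbitrary: f g)
  case 0
  then show ?case using continuous_on_eq[of "{0..1}" g f] by simp
next
  case (Suc k)
  have "\<exists>d. (g has_real_derivative d) (at x within {0..1})" if "x \<in> {0..1}" for x
    using Suc.prems(1) that by (simp add: differentiable_on_def real_differentiable_def)
  then obtain d where d: "\<And>x. x \<in> {0..1} \<Longrightarrow> (g has_real_derivative d x) (at x within {0..1})"
    by metis
  have fd: "(f has_real_derivative d x) (at x within {0..1})" if "x \<in> {0..1}" for x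
    using that Suc.prems(2) d[OF that] by (rule has_real_derivative_cong_on)
  have "Ck_unit k (dx f)"
  proof (rule Suc.IH)
    show "Ck_unit k (dx g)" using Suc.prems(1) by simp
    show "dx f x = dx g x" if "x \<in> {0..1}" for x
      using dx_unique[OF that fd] dx_unique[OF that d] that by simp
  qed
  moreover have "f differentiable_on {0..1}"
    unfolding differentiable_on_def real_differentiable_def using fd by blast
  ultimately show ?case by simp
qed

lemma Ck_unit_SucI:
  assumes "\<And>x. x \<in> {0..1} \<Longrightarrow> (f has_real_derivative f' x) (at x within {0..1})"
    and "Ck_unit k f'"
  shows "Ck_unit (Suc k) f"
proof -
  have "f differentiable_on {0..1}"
    unfolding differentiable_on_def real_differentiable_def using assms(1) by blast
  moreover have "Ck_unit k (dx f)"
    using assms(2) by (rule Ck_unit_cong) (use assms(1) dx_unique in blast)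
  ultimately show ?thesis by simp
qed

theorem theorem4p7:
  fixes \<Gamma> \<alpha> \<kappa> c\<^sub>v \<nu> :: real
    and \<rho>\<^sub>0 u\<^sub>0 e\<^sub>0 u\<^sub>1 e\<^sub>1 :: real
  assumes "\<Gamma> > 0" "\<alpha> > 0" "\<kappa> > 0" "c\<^sub>v > 0"
    and "\<nu> = \<kappa> / c\<^sub>v"
    and "\<rho>\<^sub>0 > 0" "u\<^sub>0 > 0" "e\<^sub>0 > 0"
    and "u\<^sub>1 > 0" "e\<^sub>1 > 0"
  shows "\<exists>\<rho> u e. steady_NS_solution \<Gamma> \<alpha> \<nu> \<rho> u e \<and>
           \<rho> 0 = \<rho>\<^sub>0 \<and> u 0 = u\<^sub>0 \<and> e 0 = e\<^sub>0 \<and> u 1 = u\<^sub>1 \<and> e 1 = e\<^sub>1"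
proof -
  define m where "m = \<rho>\<^sub>0 * u\<^sub>0"
  have pos: "m > 0" "\<nu> > 0" using assms by (auto simp: m_def)
  define a n where "a = \<alpha> / m" and "n = \<nu> / m"
  have an: "a > 0" "n > 0" "\<alpha> = a * m" "\<nu> = n * m" using pos assms by (auto simp: a_def n_def)
  obtain c\<^sub>1 c\<^sub>2 u e where
    du: "\<And>t. t \<in> {0..1} \<Longrightarrow> (u has_real_derivative (u t - c\<^sub>1 + \<Gamma> * (e t / u t)) / a) (at t within {0..1})"
    and de: "\<And>t. t \<in> {0..1} \<Longrightarrow>
      (e has_real_derivative (e t - c\<^sub>2 + (c\<^sub>1 * u t - (u t)\<^sup>2 / 2)) / n) (at t within {0..1})"
    and u: "\<And>t. t \<in> {0..1} \<Longrightarrow> u t > 0" and e: "\<And>t. t \<in> {0..1} \<Longrightarrow> e t > 0"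
    and bc: "u 0 = u\<^sub>0" "e 0 = e\<^sub>0" "u 1 = u\<^sub>1" "e 1 = e\<^sub>1"
    by (rule normalized_system_solvable[OF an(1,2) assms(1,7-10)]) (rule that; assumption)
  define \<rho> where "\<rho> t = m / u t" for t
  define u\<^sub>x e\<^sub>x where "u\<^sub>x t = (u t - c\<^sub>1 + \<Gamma> * (e t / u t)) / a"
    and "e\<^sub>x t = (e t - c\<^sub>2 + (c\<^sub>1 * u t - (u t)\<^sup>2 / 2)) / n" for t
  define u\<^sub>x\<^sub>x e\<^sub>x\<^sub>x where "u\<^sub>x\<^sub>x t = (u\<^sub>x t + \<Gamma> * ((e\<^sub>x t * u t - e t * u\<^sub>x t) / (u t * u t))) / a"
    and "e\<^sub>x\<^sub>x t = (e\<^sub>x t + (c\<^sub>1 * u\<^sub>x t - u t * u\<^sub>x t)) / n" for t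
  have u_nz: "u t \<noteq> 0" if "t \<in> {0..1}" for t using u[OF that] by simp
  note du = du[folded u\<^sub>x_def] and de = de[folded e\<^sub>x_def]
  have duu: "(u\<^sub>x has_real_derivative u\<^sub>x\<^sub>x t) (at t within {0..1})" if "t \<in> {0..1}" for t
  proof -
    have "((\<lambda>t. (u t - c\<^sub>1 + \<Gamma> * (e t / u t)) / a) has_real_derivative u\<^sub>x\<^sub>x t) (at t within {0..1})"
      unfolding u\<^sub>x\<^sub>x_def
      by (rule derivative_eq_intros du[OF that] de[OF that] u_nz[OF that] refl | use an in simp)+
    then show ?thesis unfolding u\<^sub>x_def[abs_def] .
  qed
  have dee: "(e\<^sub>x has_real_derivative e\<^sub>x\<^sub>x t) (at t within {0..1})" if "t \<in> {0..1}" for t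
  proof -
    have "((\<lambda>t. (e t - c\<^sub>2 + (c\<^sub>1 * u t - (u t)\<^sup>2 / 2)) / n) has_real_derivative e\<^sub>x\<^sub>x t) (at t within {0..1})"
      unfolding e\<^sub>x\<^sub>x_def
      by (rule derivative_eq_intros du[OF that] de[OF that] refl | use an in simp)+
    then show ?thesis unfolding e\<^sub>x_def[abs_def] .
  qed
  have cont: "continuous_on {0..1} u" "continuous_on {0..1} e"
      "continuous_on {0..1} u\<^sub>x" "continuous_on {0..1} e\<^sub>x"
    by (rule DERIV_continuous_on, erule du de duu dee)+
  have cont2: "continuous_on {0..1} u\<^sub>x\<^sub>x" "continuous_on {0..1} e\<^sub>x\<^sub>x"
    unfolding u\<^sub>x\<^sub>x_def[abs_def] e\<^sub>x\<^sub>x_def[abs_def]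
    by (intro continuous_intros cont; use u_nz an in simp)+
  have "Ck_unit 2 u" "Ck_unit 2 e"
    unfolding numeral_2_eq_2
    by (rule Ck_unit_SucI[OF du Ck_unit_SucI[OF duu]] Ck_unit_SucI[OF de Ck_unit_SucI[OF dee]];
        simp add: cont2)+
  moreover have "Ck_unit 1 \<rho>"
    unfolding One_nat_def
  proof (rule Ck_unit_SucI)
    show "(\<rho> has_real_derivative - (m * u\<^sub>x x / (u x * u x))) (at x within {0..1})" if "x \<in> {0..1}" for x
      unfolding \<rho>_def by (rule derivative_eq_intros du[OF that] u_nz[OF that] refl | simp)+
    show "Ck_unit 0 (\<lambda>x. - (m * u\<^sub>x x / (u x * u x)))"
      unfolding Ck_unit.simps by (intro continuous_intros cont) (use u_nz in simp)
  qed
  moreover have "\<rho> x > 0" if "x \<in> {0..1}" for x using u[OF that] pos by (simp add: \<rho>_def)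
  moreover have "dx (\<lambda>y. \<rho> y * u y) x = 0" if "x \<in> {0..1}" for x
    using that by (rule dx_eqI[where g = "\<lambda>_. m"]) (auto simp: \<rho>_def u_nz)
  moreover have "dx (\<lambda>y. \<rho> y * (u y)\<^sup>2 + \<Gamma> * \<rho> y * e y) x = \<alpha> * dx (dx u) x"
    and "dx (\<lambda>y. \<rho> y * u y * (e y + (u y)\<^sup>2 / 2) + \<Gamma> * \<rho> y * e y * u y) x
          = \<nu> * dx (dx e) x + dx (\<lambda>y. \<alpha> * u y * dx u y) x" if x: "x \<in> {0..1}" for x
  proof -
    have dxu: "dx u y = u\<^sub>x y" and dxe: "dx e y = e\<^sub>x y" if "y \<in> {0..1}" for y
      by (rule dx_unique[OF that du[OF that]], rule dx_unique[OF that de[OF that]])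
    have dxx: "dx (dx u) x = u\<^sub>x\<^sub>x x" "dx (dx e) x = e\<^sub>x\<^sub>x x"
      by (rule dx_eqI[OF x _ duu[OF x]] dx_eqI[OF x _ dee[OF x]]; simp add: dxu dxe)+
    \<comment> \<open>The first integral read backwards: the momentum flux is the viscous stress
      plus the constant \<open>m * c\<^sub>1\<close>.\<close>
    have "dx (\<lambda>y. \<rho> y * (u y)\<^sup>2 + \<Gamma> * \<rho> y * e y) x = \<alpha> * u\<^sub>x\<^sub>x x"
    proof (rule dx_eqI[OF x])
      show "((\<lambda>y. \<alpha> * u\<^sub>x y + m * c\<^sub>1) has_real_derivative \<alpha> * u\<^sub>x\<^sub>x x) (at x within {0..1})"
        by (rule derivative_eq_intros duu[OF x] refl | simp)+
      show "\<rho> y * (u y)\<^sup>2 + \<Gamma> * \<rho> y * e y = \<alpha> * u\<^sub>x y + m * c\<^sub>1" if "y \<in> {0..1}" for y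
        using u_nz[OF that] an by (simp add: \<rho>_def u\<^sub>x_def power2_eq_square field_simps)
    qed
    then show "dx (\<lambda>y. \<rho> y * (u y)\<^sup>2 + \<Gamma> * \<rho> y * e y) x = \<alpha> * dx (dx u) x" by (simp add: dxx)
    define d where "d = \<alpha> * (u\<^sub>x x * u\<^sub>x x + u x * u\<^sub>x\<^sub>x x)"
    have deriv: "((\<lambda>y. \<alpha> * u y * u\<^sub>x y) has_real_derivative d) (at x within {0..1})"
      unfolding d_def by (rule derivative_eq_intros du[OF x] duu[OF x] refl | simp add: algebra_simps)+
    have "dx (\<lambda>y. \<alpha> * u y * dx u y) x = d"
      by (rule dx_eqI[OF x _ deriv]) (simp add: dxu)
    moreover have "dx (\<lambda>y. \<rho> y * u y * (e y + (u y)\<^sup>2 / 2) + \<Gamma> * \<rho> y * e y * u y) x = \<nu> * e\<^sub>x\<^sub>x x + d"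
    proof (rule dx_eqI[OF x])
      show "((\<lambda>y. \<nu> * e\<^sub>x y + \<alpha> * u y * u\<^sub>x y + m * c\<^sub>2) has_real_derivative \<nu> * e\<^sub>x\<^sub>x x + d) (at x within {0..1})"
        by (rule derivative_eq_intros dee[OF x] deriv refl | simp)+
      show "\<rho> y * u y * (e y + (u y)\<^sup>2 / 2) + \<Gamma> * \<rho> y * e y * u y = \<nu> * e\<^sub>x y + \<alpha> * u y * u\<^sub>x y + m * c\<^sub>2"
        if "y \<in> {0..1}" for y
      proof -
        have "\<nu> * e\<^sub>x y = m * (e y - c\<^sub>2 + (c\<^sub>1 * u y - (u y)\<^sup>2 / 2))"
          using an by (simp add: e\<^sub>x_def)
        \<comment> \<open>The momentum equation times \<open>u\<close> restores the pressure work
          missing from \<open>e\<^sub>x\<close>; the terms \<open>c\<^sub>1 * u\<close> cancel in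
          the sum.\<close>
        moreover have "\<alpha> * u y * u\<^sub>x y = m * ((u y)\<^sup>2 - c\<^sub>1 * u y + \<Gamma> * e y)"
          using an u_nz[OF that] by (simp add: u\<^sub>x_def power2_eq_square field_simps)
        moreover have "\<rho> y * u y = m" using u_nz[OF that] by (simp add: \<rho>_def)
        then have "\<rho> y * u y * (e y + (u y)\<^sup>2 / 2) + \<Gamma> * \<rho> y * e y * u y
            = m * (e y + (u y)\<^sup>2 / 2) + \<Gamma> * m * e y"
          by (metis mult.assoc mult.commute)
        ultimately show ?thesis by (simp add: field_simps)
      qed
    qed
    ultimately show "dx (\<lambda>y. \<rho> y * u y * (e y + (u y)\<^sup>2 / 2) + \<Gamma> * \<rho> y * e y * u y) x
          = \<nu> * dx (dx e) x + dx (\<lambda>y. \<alpha> * u y * dx u y) x" by (simp add: dxx)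
  qed
  ultimately have "steady_NS_solution \<Gamma> \<alpha> \<nu> \<rho> u e"
    unfolding steady_NS_solution_def using u e by blast
  moreover have "\<rho> 0 = \<rho>\<^sub>0" using assms bc by (simp add: \<rho>_def m_def)
  ultimately show ?thesis using bc by blast
qed

end
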